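(* Let $k\geq 1$, let $K$ be a convex body contained in the interior of the unit ball of $\mathbb{R}^{2k+1}$ centred at the origin, and let $L$ be a $2k$-dimensional convex body. Suppose that for every unit vector $x\in\mathbb{S}^{2k}$ the set $C(K,x)\cap x^{\bot}$ is a convex body congruent to $L$. Then $K$ is a Euclidean ball.
   Context: A convex body is a compact convex set with non-empty interior; a $2k$-dimensional convex body in $\mathbb{R}^{2k+1}$ is a compact convex set contained in some hyperplane and having non-empty interior relative to that hyperplane. For a convex body $K\subset\mathbb{R}^n$ and a point $x\in\mathbb{R}^n\setminus K$, $C(K,x)=\{x+\lambda(y-x): y\in K,\ \lambda\geq 0\}$ is the cone generated by $K$ with apex $x$. $x^{\bot}$ denotes the hyperplane through the origin orthogonal to $x$. Two sets in $\mathbb{R}^{2k+1}$ are congruent if some isometry of $\mathbb{R}^{2k+1}$ maps one onto the other. *)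

theory Defs
  imports "HOL-Analysis.Analysis"
begin

definition convex_body :: "'a::euclidean_space set \<Rightarrow> bool" where
  "convex_body K \<longleftrightarrow> compact K \<and> convex K \<and> interior K \<noteq> {}"

definition hyperplane_convex_body :: "'a::euclidean_space set \<Rightarrow> bool" where
  "hyperplane_convex_body L \<longleftrightarrow> compact L \<and> convex L \<and>
     (\<exists>a b. a \<noteq> 0 \<and> L \<subseteq> {y. a \<bullet> y = b} \<and>
        (top_of_set {y. a \<bullet> y = b}) interior_of L \<noteq> {})"

definition generated_cone :: "'a::euclidean_space set \<Rightarrow> 'a \<Rightarrow> 'a set" where
  "generated_cone K x = {x + t *\<^sub>R (y - x) | y t. y \<in> K \<and> t \<ge> (0::real)}"

(* Surjectivity of f is automatic: a distance-preserving self-map of a Euclidean space is onto. *)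
definition congruent_sets :: "'a::euclidean_space set \<Rightarrow> 'a set \<Rightarrow> bool" where
  "congruent_sets A B \<longleftrightarrow> (\<exists>f :: 'a \<Rightarrow> 'a. (\<forall>u v. dist (f u) (f v) = dist u v) \<and> f ` A = B)"

end

theory Submission
  imports Defs "HOL-Homology.Homology"
begin

text \<open>For a unit vector \<open>x\<close> the section \<open>C(K,x) \<inter> x\<^sup>\<bottom>\<close> is the image of \<open>K\<close> under central projection from \<open>x\<close>.
  Its width function is a seminorm on the tangent space of the sphere at \<open>x\<close>, and by congruence all
  these seminorms are isometric. If they were not constant on unit vectors, a direction of minimal
  width at one point could be transported continuously, keeping almost minimal width, to the
  sphere minus a small cap. As the field avoids the directions of maximal width near the cap, it
  extends to a nowhere vanishing tangent field, contradicting the hairy ball theorem. The transport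
  uses that on an orbit of the orthogonal group, nearby elements differ by group elements of
  proportionally small displacement.

  So every section has the same constant width \<open>2r\<close>. In a plane through the origin let \<open>tan \<alpha>\<close> and
  \<open>tan \<beta>\<close> be the slopes of the two tangents from a point of the unit circle; then
  \<open>tan \<alpha> + tan \<beta> = 2r\<close>. Following the tangent chords gives a circle homeomorphism whose square rotates each
  level set of \<open>\<alpha>\<close> rigidly by \<open>- 2(\<alpha> + \<beta>)\<close>. Rotation numbers do not depend on the orbit, hence \<open>\<alpha> + \<beta>\<close> and
  then \<open>\<alpha>\<close> are constant, so that the support function of \<open>K\<close> is constant.\<close>

section \<open>The hairy ball theorem\<close>

text \<open>Congruences of sections may contain unknown translations, which change support functions
  by linear terms; widths forget them. The price is that only the sum of two tangent slopes is
  controlled, and the chord dynamics is what separates the two again. In the transport, a continuous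
  choice of a minimal direction need not exist, so none is followed exactly: at each step finitely
  many nearby candidates are averaged with continuous weights. The loss from averaging is quadratic
  in the spread of the candidates, and about \<open>1/d\<close> steps of length \<open>d\<close> are
  needed. A spread of \<open>O(d)\<close> therefore gives a small total loss, whereas mere
  continuity of the congruences would not bound it; this is why the orbit estimate has to be linear.
  It is proved without Lie theory, from compactness of the orthogonal group and high powers of
  elements near the identity. The parity of \<open>2k + 1\<close> enters through the antipodal map,
  which has degree \<open>-1\<close> on a sphere of dimension \<open>2k\<close>.\<close>

lemma continuous_map_nsphere_permute:
  assumes "\<pi> permutes {..n}"
  shows "continuous_map (nsphere n) (nsphere n) (\<lambda>x. x \<circ> \<pi>)"
proof -
  have s: "(\<Sum>i\<le>n. (x (\<pi> i))\<^sup>2) = (\<Sum>i\<le>n. (x i)\<^sup>2)" for x :: "nat \<Rightarrow> real"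
    using sum.permute[OF assms, of "\<lambda>i. (x i)\<^sup>2"] by (simp add: o_def)
  have o: "\<pi> i = i" if "i > n" for i
    using assms that by (auto simp: permutes_def)
  show ?thesis
    unfolding nsphere
    by (auto simp: continuous_map_in_subtopology continuous_map_componentwise_UNIV s o
        intro!: continuous_map_from_subtopology continuous_map_product_projection)
qed

text \<open>Conjugation by the transposition of coordinates \<open>0\<close> and \<open>k\<close>
  moves the sign change to coordinate \<open>0\<close>. The degree of the transposition occurs
  twice, and its square is \<open>1\<close> because the transposition is an involution.\<close>

lemma Brouwer_degree2_reflection_coordinate:
  assumes "k \<le> n"
  shows "Brouwer_degree2 n (\<lambda>x i. if i = k then -x i else x i) = -1"
proof -
  define \<pi> where "\<pi> = Transposition.transpose 0 k"
  have "\<pi> permutes {..n}"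
    unfolding \<pi>_def by (rule permutes_swap_id) (use assms in auto)
  define sw where "sw = (\<lambda>x::nat\<Rightarrow>real. x \<circ> \<pi>)"
  let ?r = "\<lambda>k (x::nat\<Rightarrow>real) i. if i = k then -x i else x i"
  have sw: "continuous_map (nsphere n) (nsphere n) sw"
    unfolding sw_def by (rule continuous_map_nsphere_permute) fact
  have r: "continuous_map (nsphere n) (nsphere n) (?r j)" for j
    by (rule continuous_map_nsphere_reflection)
  have "sw \<circ> sw = id" by (auto simp: sw_def \<pi>_def fun_eq_iff)
  then have 1: "Brouwer_degree2 n sw * Brouwer_degree2 n sw = 1"
    using Brouwer_degree2_compose[OF sw sw] by simp
  have "?r k = sw \<circ> (?r 0 \<circ> sw)"
    by (auto simp: sw_def \<pi>_def fun_eq_iff Transposition.transpose_def)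
  then have "Brouwer_degree2 n (?r k) = Brouwer_degree2 n sw * (Brouwer_degree2 n (?r 0) * Brouwer_degree2 n sw)"
    by (simp add: Brouwer_degree2_compose sw r continuous_map_compose[OF sw r])
  then show ?thesis
    using 1 by (simp add: Brouwer_degree2_reflection)
qed

text \<open>The antipodal map is the composition of \<open>n + 1\<close> coordinate reflections,
  each of degree \<open>-1\<close>.\<close>

lemma Brouwer_degree2_antipodal:
  "Brouwer_degree2 n (\<lambda>x i. - x i) = (-1) ^ Suc n"
proof -
  define neg where "neg = (\<lambda>m (x::nat\<Rightarrow>real) i. if i < m then - x i else x i)"
  let ?r = "\<lambda>k (x::nat\<Rightarrow>real) i. if i = k then -x i else x i"
  have st: "neg (Suc m) = ?r m \<circ> neg m" for m
    by (auto simp: neg_def fun_eq_iff)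
  \<comment> \<open>The degree claim stops at \<open>m = Suc n\<close> because the sphere has only
    the coordinates \<open>0\<close> to \<open>n\<close>.\<close>
  have "continuous_map (nsphere n) (nsphere n) (neg m) \<and>
     (m \<le> Suc n \<longrightarrow> Brouwer_degree2 n (neg m) = (-1)^m)" for m
  proof (induction m)
    case 0
    have "neg 0 = id" by (auto simp: neg_def fun_eq_iff)
    then show ?case using Brouwer_degree2_id by (simp del: id_apply add: id_def[symmetric])
  next
    case (Suc m)
    have r: "continuous_map (nsphere n) (nsphere n) (?r m)"
      by (rule continuous_map_nsphere_reflection)
    have "continuous_map (nsphere n) (nsphere n) (?r m \<circ> neg m)"
      using Suc r by (blast intro: continuous_map_compose)
    moreover have "Brouwer_degree2 n (?r m \<circ> neg m) = (-1) ^ Suc m" if "Suc m \<le> Suc n"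
    proof -
      have "Brouwer_degree2 n (?r m \<circ> neg m) = Brouwer_degree2 n (?r m) * Brouwer_degree2 n (neg m)"
        using Suc r by (intro Brouwer_degree2_compose) auto
      then show ?thesis using that Suc by (simp add: Brouwer_degree2_reflection_coordinate)
    qed
    ultimately show ?case unfolding st by blast
  qed
  then have "Brouwer_degree2 n (neg (Suc n)) = (-1) ^ Suc n" by blast
  moreover have "Brouwer_degree2 n (\<lambda>x i. - x i) = Brouwer_degree2 n (neg (Suc n))"
    by (rule Brouwer_degree2_eq) (auto simp: neg_def fun_eq_iff nsphere)
  ultimately show ?thesis by simp
qed

lemma norm_cos_sin:
  fixes x w :: "'a::real_inner"
  assumes "norm x = 1" "norm w = 1" "x \<bullet> w = 0"
  shows "norm (cos t *\<^sub>R x + sin t *\<^sub>R w) = 1"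
proof -
  have "x \<bullet> x = 1" "w \<bullet> w = 1" using assms by (simp_all add: norm_eq_1)
  then have "(cos t *\<^sub>R x + sin t *\<^sub>R w) \<bullet> (cos t *\<^sub>R x + sin t *\<^sub>R w) = 1"
    using assms(3) by (simp add: inner_add_left inner_add_right inner_commute flip: power2_eq_square)
  then show ?thesis by (simp add: norm_eq_1)
qed

theorem hairy_ball:
  fixes V :: "real ^ 'n \<Rightarrow> real ^ 'n"
  assumes odd: "odd (CARD('n))"
    and cont: "continuous_on (sphere 0 1) V"
    and tangent: "\<And>x. norm x = 1 \<Longrightarrow> x \<bullet> V x = 0"
  shows "\<exists>x. norm x = 1 \<and> V x = 0"
proof (rule ccontr)
  assume "\<not> ?thesis"
  then have nz: "V x \<noteq> 0" if "norm x = 1" for x using that by blast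
  let ?S = "sphere (0::real^'n) 1"
  \<comment> \<open>The half great circle from \<open>x\<close> in the direction of
    \<open>V x\<close> ends at the antipode, so a nowhere vanishing tangent field makes the identity
    homotopic to the antipodal map.\<close>
  define h where "h = (\<lambda>p::real \<times> (real^'n). cos (pi * fst p) *\<^sub>R snd p + sin (pi * fst p) *\<^sub>R (V (snd p) /\<^sub>R norm (V (snd p))))"
  have conth: "continuous_on ({0..1} \<times> ?S) h"
    unfolding h_def
    by (intro continuous_intros continuous_on_compose2[OF cont] ) (auto simp: nz)
  have normh: "norm (h (t,x)) = 1" if "norm x = 1" for t x
    unfolding h_def fst_conv snd_conv using that nz[OF that] tangent[OF that]
    by (intro norm_cos_sin) auto
  have hom: "homotopic_with (\<lambda>x. True) (top_of_set ?S) (top_of_set ?S) id uminus"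
    unfolding homotopic_with_def
  proof (intro exI[of _ h] conjI allI ballI)
    show "continuous_map (prod_topology (top_of_set {0..1}) (top_of_set ?S)) (top_of_set ?S) h"
      using conth by (auto simp: prod_topology_subtopology_eu normh image_subset_iff_funcset[symmetric])
  qed (auto simp: h_def)
  define p where "p = CARD('n) - 1"
  have p: "CARD('n) = Suc p" by (simp add: p_def)
  obtain d where d: "bij_betw d {..p} (UNIV::'n set)"
    using ex_bij_betw_nat_finite[of "UNIV::'n set"] p
    by (metis finite atLeast0LessThan lessThan_Suc_atMost)
  define c where "c = inv_into {..p} d"
  have c: "bij_betw c (UNIV::'n set) {..p}" unfolding c_def by (rule bij_betw_inv_into[OF d])
  have dc: "d (c i) = i" for i unfolding c_def using bij_betw_inv_into_right[OF d] by simp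
  have cd: "c (d j) = j" if "j \<le> p" for j unfolding c_def using bij_betw_inv_into_left[OF d] that by simp
  have cp: "c i \<le> p" for i using c by (auto simp: bij_betw_def)
  \<comment> \<open>\<open>F\<close> and \<open>G\<close> identify the sphere of
    \<open>real ^ 'n\<close> with \<open>nsphere p\<close>, where degrees are defined;
    \<open>G\<close> pads with zeros beyond index \<open>p\<close>.\<close>
  define F where "F = (\<lambda>x::nat\<Rightarrow>real. (\<chi> i. x (c i)) :: real^'n)"
  define G where "G = (\<lambda>u::real^'n. \<lambda>j. if j \<le> p then u $ d j else 0)"
  have "continuous_map (nsphere p) euclidean F"
  proof -
    have "continuous_on UNIV F"
      unfolding F_def by (intro continuous_intros continuous_on_product_coordinates)
    then have "continuous_map (powertop_real UNIV) euclidean F"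
      by (simp add: euclidean_product_topology)
    then show ?thesis
      unfolding nsphere by (rule continuous_map_from_subtopology)
  qed
  moreover have "F x \<in> ?S" if "x \<in> topspace (nsphere p)" for x
  proof -
    have "(\<Sum>i\<in>UNIV. (x (c i))\<^sup>2) = (\<Sum>i\<le>p. (x i)\<^sup>2)"
      by (rule sum.reindex_bij_betw[OF c])
    then show ?thesis using that by (simp add: nsphere F_def norm_eq_1 inner_vec_def flip: power2_eq_square)
  qed
  ultimately have F: "continuous_map (nsphere p) (top_of_set ?S) F"
    by (auto simp: continuous_map_in_subtopology)
  have G: "continuous_map (top_of_set ?S) (nsphere p) G"
  proof -
    have "(\<Sum>i\<le>p. (u $ d i)\<^sup>2) = 1" if "norm u = 1" for u :: "real^'n"
      using sum.reindex_bij_betw[OF d, of "\<lambda>i. (u$i)\<^sup>2"] that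
      by (simp add: norm_eq_1 inner_vec_def flip: power2_eq_square)
    moreover have "continuous_on ?S (\<lambda>u. if j \<le> p then u $ d j else 0)" for j
      by (cases "j \<le> p") (auto intro!: continuous_on_component continuous_on_id)
    ultimately show ?thesis
      unfolding nsphere
      by (auto simp: continuous_map_in_subtopology continuous_map_componentwise_UNIV G_def intro!: continuous_on_component continuous_on_id)
  qed
  have "homotopic_with (\<lambda>x. True) (nsphere p) (nsphere p) (G \<circ> (id \<circ> F)) (G \<circ> (uminus \<circ> F))"
    by (rule homotopic_with_compose_continuous_map_left[OF homotopic_with_compose_continuous_map_right[OF hom F] G]) auto
  then have "Brouwer_degree2 p (G \<circ> (id \<circ> F)) = Brouwer_degree2 p (G \<circ> (uminus \<circ> F))"
    by (rule Brouwer_degree2_homotopic)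
  moreover have "Brouwer_degree2 p (G \<circ> (id \<circ> F)) = Brouwer_degree2 p id"
    by (rule Brouwer_degree2_eq) (auto simp: F_def G_def cd fun_eq_iff nsphere)
  moreover have "Brouwer_degree2 p (G \<circ> (uminus \<circ> F)) = Brouwer_degree2 p (\<lambda>x i. - x i)"
    by (rule Brouwer_degree2_eq) (auto simp: F_def G_def cd fun_eq_iff nsphere)
  \<comment> \<open>\<open>p\<close> is even, so the antipodal map has degree \<open>-1\<close>
    while the identity has degree \<open>1\<close>.\<close>
  ultimately show False
    using odd by (simp add: Brouwer_degree2_antipodal p)
qed

section \<open>Orbits of the orthogonal group\<close>

text \<open>The orthogonal group inside the bounded operators: the operator norm measures
  displacement and gives the topology in which the group is compact.\<close>

definition orth_blinfuns :: "('a::euclidean_space \<Rightarrow>\<^sub>L 'a) set" where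
  "orth_blinfuns = {g. \<forall>x. norm (blinfun_apply g x) = norm x}"

lemma norm_orth_blinfun: "g \<in> orth_blinfuns \<Longrightarrow> norm (blinfun_apply g x) = norm x"
  by (simp add: orth_blinfuns_def)

lemma orth_blinfun_id: "id_blinfun \<in> orth_blinfuns"
  by (simp add: orth_blinfuns_def)

lemma orth_blinfun_compose: "g \<in> orth_blinfuns \<Longrightarrow> h \<in> orth_blinfuns \<Longrightarrow> g o\<^sub>L h \<in> orth_blinfuns"
  by (simp add: orth_blinfuns_def)

lemma onorm_orth_blinfun_le: "g \<in> orth_blinfuns \<Longrightarrow> norm g \<le> 1"
  by (rule norm_blinfun_bound) (auto simp: norm_orth_blinfun)

lemma orth_blinfun_inner:
  assumes "g \<in> orth_blinfuns"
  shows "blinfun_apply g u \<bullet> blinfun_apply g v = u \<bullet> v"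
proof -
  have "orthogonal_transformation (blinfun_apply g)"
    using assms by (simp add: orthogonal_transformation norm_orth_blinfun bounded_linear.linear blinfun.bounded_linear_right)
  then show ?thesis by (simp add: orthogonal_transformation_def)
qed

lemma orth_blinfun_inverse:
  fixes g :: "'a::euclidean_space \<Rightarrow>\<^sub>L 'a"
  assumes "g \<in> orth_blinfuns"
  obtains g' where "g' \<in> orth_blinfuns" "g o\<^sub>L g' = id_blinfun" "g' o\<^sub>L g = id_blinfun"
proof -
  have "linear (blinfun_apply g)" by (simp add: bounded_linear.linear blinfun.bounded_linear_right)
  then have o: "orthogonal_transformation (blinfun_apply g)"
    using assms by (simp add: orthogonal_transformation norm_orth_blinfun)
  define i where "i = inv_into UNIV (blinfun_apply g)"
  have bij: "bij (blinfun_apply g)" using orthogonal_transformation_bij[OF o] .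
  have "orthogonal_transformation i"
    unfolding i_def by (rule orthogonal_transformation_inv[OF o])
  then have "bounded_linear i" "\<And>x. norm (i x) = norm x"
    by (auto simp: orthogonal_transformation linear_conv_bounded_linear)
  note i = this bounded_linear_Blinfun_apply[OF this(1)]
  show ?thesis
  proof
    show "Blinfun i \<in> orth_blinfuns" using i by (simp add: orth_blinfuns_def)
    show "g o\<^sub>L Blinfun i = id_blinfun"
      by (rule blinfun_eqI) (simp add: i(3), simp add: i_def bij_is_surj[OF bij] surj_f_inv_f)
    show "Blinfun i o\<^sub>L g = id_blinfun"
      by (rule blinfun_eqI) (simp add: i(3), simp add: i_def bij_is_inj[OF bij])
  qed
qed

lemma compact_orth_blinfuns: "compact (orth_blinfuns :: ('a::euclidean_space \<Rightarrow>\<^sub>L 'a) set)"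
proof -
  have "bounded (orth_blinfuns :: ('a \<Rightarrow>\<^sub>L 'a) set)"
    by (rule boundedI[of _ 1]) (rule onorm_orth_blinfun_le)
  moreover have "closed (orth_blinfuns :: ('a \<Rightarrow>\<^sub>L 'a) set)"
    unfolding orth_blinfuns_def
    by (intro closed_Collect_all closed_Collect_eq continuous_intros)
  ultimately show ?thesis by (simp add: compact_eq_bounded_closed)
qed

definition blinfun_power :: "('a::real_normed_vector \<Rightarrow>\<^sub>L 'a) \<Rightarrow> nat \<Rightarrow> 'a \<Rightarrow>\<^sub>L 'a" where
  "blinfun_power g k = ((o\<^sub>L) g ^^ k) id_blinfun"

lemma blinfun_power_0 [simp]: "blinfun_power g 0 = id_blinfun"
  and blinfun_power_Suc [simp]: "blinfun_power g (Suc k) = g o\<^sub>L blinfun_power g k"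
  by (simp_all add: blinfun_power_def)

lemma orth_blinfun_power: "g \<in> orth_blinfuns \<Longrightarrow> blinfun_power g k \<in> orth_blinfuns"
  by (induction k) (auto simp: orth_blinfun_id orth_blinfun_compose)

lemmas blinfun_compose_diff_right = bounded_bilinear.diff_right[OF bounded_bilinear_blinfun_compose]

lemma blinfun_power_minus_id:
  assumes "g \<in> orth_blinfuns"
  shows "norm (blinfun_power g k - id_blinfun) \<le> k * norm (g - id_blinfun)"
proof (induction k)
  case (Suc k)
  have "blinfun_power g (Suc k) - id_blinfun =
      (g o\<^sub>L (blinfun_power g k - id_blinfun)) + (g - id_blinfun)"
    by (rule blinfun_eqI) (simp add: blinfun.diff_left blinfun.diff_right blinfun.add_left)
  moreover have "norm (g o\<^sub>L (blinfun_power g k - id_blinfun)) \<le> 1 * norm (blinfun_power g k - id_blinfun)"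
    using onorm_orth_blinfun_le[OF assms]
    by (meson norm_blinfun_compose mult_right_mono norm_ge_zero order_trans)
  ultimately have "norm (blinfun_power g (Suc k) - id_blinfun) \<le> norm (blinfun_power g k - id_blinfun) + norm (g - id_blinfun)"
    by (metis add_mono_thms_linordered_semiring(3) mult_1 norm_triangle_le)
  with Suc show ?case by (simp add: algebra_simps)
qed auto

text \<open>Each step adds an error \<open>g - id_blinfun\<close> times a displacement of at most
  \<open>k * norm (g - id_blinfun)\<close>. For \<open>k\<close> about
  \<open>s / norm (g - id_blinfun)\<close> the bound is about the square of \<open>s\<close>,
  however close \<open>g\<close> is to the identity.\<close>

lemma blinfun_power_linearisation:
  assumes "g \<in> orth_blinfuns"
  shows "norm (blinfun_power g k - id_blinfun - k *\<^sub>R (g - id_blinfun)) \<le> (k * norm (g - id_blinfun))\<^sup>2"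
proof (induction k)
  case (Suc k)
  let ?e = "g - id_blinfun"
  have "blinfun_power g (Suc k) - id_blinfun - Suc k *\<^sub>R ?e =
     (blinfun_power g k - id_blinfun - k *\<^sub>R ?e) + (?e o\<^sub>L (blinfun_power g k - id_blinfun))"
    by (rule blinfun_eqI) (simp add: blinfun.diff_left blinfun.diff_right blinfun.add_left blinfun.scaleR_left algebra_simps)
  moreover have "norm (?e o\<^sub>L (blinfun_power g k - id_blinfun)) \<le> norm ?e * (k * norm ?e)"
    using blinfun_power_minus_id[OF assms, of k]
    by (meson norm_blinfun_compose mult_left_mono norm_ge_zero order_trans)
  ultimately have "norm (blinfun_power g (Suc k) - id_blinfun - Suc k *\<^sub>R ?e) \<le> (k * norm ?e)\<^sup>2 + norm ?e * (k * norm ?e)"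
    using Suc by (metis add_mono norm_triangle_le)
  also have "\<dots> \<le> (Suc k * norm ?e)\<^sup>2"
    by (simp add: power2_eq_square algebra_simps)
  finally show ?case .
qed auto

section \<open>Approximate stabilisers and displacement on orbits\<close>

lemma orbit_power_bound:
  assumes g: "g \<in> orth_blinfuns" and e: "\<And>u. norm u \<le> 1 \<Longrightarrow> \<bar>f (blinfun_apply g u) - f u\<bar> \<le> (e::real)"
    and u: "norm u \<le> 1"
  shows "\<bar>f (blinfun_apply (blinfun_power g k) u) - f u\<bar> \<le> k * e"
proof (induction k)
  case (Suc k)
  have "\<bar>f (g (blinfun_power g k u)) - f (blinfun_power g k u)\<bar> \<le> e"
    by (rule e) (simp add: norm_orth_blinfun orth_blinfun_power g u)
  with Suc show ?case by (simp add: algebra_simps)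
qed auto

lemma stabiliser_limit:
  fixes f :: "'a::euclidean_space \<Rightarrow> real"
  assumes f: "continuous_on UNIV f"
    and lim: "q \<longlonglongrightarrow> g" and q: "\<And>n. q n \<in> orth_blinfuns"
    and e: "\<And>n u. norm u \<le> 1 \<Longrightarrow> \<bar>f (blinfun_apply (q n) u) - f u\<bar> \<le> e n" and e0: "e \<longlonglongrightarrow> 0"
  shows "g \<in> orth_blinfuns" "\<And>u. norm u \<le> 1 \<Longrightarrow> f (blinfun_apply g u) = f u"
proof -
  show "g \<in> orth_blinfuns"
    using compact_imp_closed[OF compact_orth_blinfuns] q lim closed_sequentially by blast
  fix u :: 'a assume u: "norm u \<le> 1"
  have "(\<lambda>n. blinfun_apply (q n) u) \<longlonglongrightarrow> blinfun_apply g u" by (intro tendsto_intros lim)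
  then have "(\<lambda>n. f (blinfun_apply (q n) u)) \<longlonglongrightarrow> f (blinfun_apply g u)"
    using f continuous_on_tendsto_compose by fastforce
  then have 1: "(\<lambda>n. \<bar>f (blinfun_apply (q n) u) - f u\<bar>) \<longlonglongrightarrow> \<bar>f (blinfun_apply g u) - f u\<bar>"
    by (intro tendsto_intros)
  have "\<bar>f (blinfun_apply g u) - f u\<bar> \<le> 0"
    by (rule LIMSEQ_le[OF 1 e0]) (use e[OF u] in blast)
  then show "f (blinfun_apply g u) = f u" by simp
qed

text \<open>The key point of the proof: if \<open>g\<close> is the shortest element of its coset modulo the stabiliser and
  moves \<open>f\<close> much less than it moves points, then a power of \<open>g\<close> approximates an element of the
  stabiliser that can be used to shorten \<open>g\<close>.\<close>

lemma orbit_displacement: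
  fixes f :: "'a::euclidean_space \<Rightarrow> real"
  assumes f: "continuous_on UNIV f"
  shows "\<exists>C>0. \<forall>g\<in>orth_blinfuns. \<forall>e.
    (\<forall>u. norm u \<le> 1 \<longrightarrow> \<bar>f (blinfun_apply g u) - f u\<bar> \<le> e) \<longrightarrow>
    (\<exists>q\<in>orth_blinfuns. (\<forall>u. norm u \<le> 1 \<longrightarrow> f (blinfun_apply q u) = f (blinfun_apply g u)) \<and>
       norm (q - id_blinfun) \<le> C * e)"
proof (rule ccontr)
  assume neg: "\<not> ?thesis"
  \<comment> \<open>A counterexample to the constant \<open>n + 1\<close>, taken as a shortest
    element of its coset: composition with a stabiliser element \<open>h\<close> never brings it
    closer to the identity.\<close>
  define P where "P = (\<lambda>n (q::'a \<Rightarrow>\<^sub>L 'a) e. q \<in> orth_blinfuns \<and>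
      (\<forall>u. norm u \<le> 1 \<longrightarrow> \<bar>f (blinfun_apply q u) - f u\<bar> \<le> e) \<and> real (Suc n) * e < norm (q - id_blinfun) \<and>
      (\<forall>h\<in>orth_blinfuns. (\<forall>u. norm u \<le> 1 \<longrightarrow> f (blinfun_apply h u) = f u) \<longrightarrow> norm (q - id_blinfun) \<le> norm ((h o\<^sub>L q) - id_blinfun)))"
  have neg': "\<exists>g\<in>orth_blinfuns. \<exists>e. (\<forall>u. norm u \<le> 1 \<longrightarrow> \<bar>f (blinfun_apply g u) - f u\<bar> \<le> e) \<and>
    (\<forall>q\<in>orth_blinfuns. (\<forall>u. norm u \<le> 1 \<longrightarrow> f (blinfun_apply q u) = f (blinfun_apply g u)) \<longrightarrow>
       C * e < norm (q - id_blinfun))" if "C > 0" for C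
  proof (rule ccontr)
    assume n: "\<not> ?thesis"
    have "\<exists>q\<in>orth_blinfuns. (\<forall>u. norm u \<le> 1 \<longrightarrow> f (blinfun_apply q u) = f (blinfun_apply g u)) \<and> norm (q - id_blinfun) \<le> C * e"
      if "g \<in> orth_blinfuns" "\<forall>u. norm u \<le> 1 \<longrightarrow> \<bar>f (blinfun_apply g u) - f u\<bar> \<le> e" for g e
    proof (rule ccontr)
      assume c: "\<not> ?thesis"
      show False
        by (rule notE[OF n], rule bexI[OF _ that(1)], rule exI[of _ e])
          (use c that(2) in \<open>simp add: not_le, blast\<close>)
    qed
    with \<open>C > 0\<close> have "\<exists>C>0. \<forall>g\<in>orth_blinfuns. \<forall>e.
      (\<forall>u. norm u \<le> 1 \<longrightarrow> \<bar>f (blinfun_apply g u) - f u\<bar> \<le> e) \<longrightarrow>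
      (\<exists>q\<in>orth_blinfuns. (\<forall>u. norm u \<le> 1 \<longrightarrow> f (blinfun_apply q u) = f (blinfun_apply g u)) \<and>
       norm (q - id_blinfun) \<le> C * e)" by (intro exI[of _ C] conjI ballI allI impI) simp_all
    with neg show False by simp
  qed
  have "\<exists>q e. P n q e" for n
  proof -
    obtain g e where g: "g \<in> orth_blinfuns" and
      e: "\<forall>u. norm u \<le> 1 \<longrightarrow> \<bar>f (blinfun_apply g u) - f u\<bar> \<le> e" and
      far: "\<And>q. q \<in> orth_blinfuns \<Longrightarrow> (\<forall>u. norm u \<le> 1 \<longrightarrow> f (blinfun_apply q u) = f (blinfun_apply g u)) \<Longrightarrow>
        real (Suc n) * e < norm (q - id_blinfun)"
      using neg'[of "real (Suc n)"] by auto
    \<comment> \<open>The elements that transform \<open>f\<close> like \<open>g\<close> form a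
      compact set, so a shortest one exists.\<close>
    let ?C = "orth_blinfuns \<inter> {q. \<forall>u. norm u \<le> 1 \<longrightarrow> f (blinfun_apply q u) = f (blinfun_apply g u)}"
    have "closed {q. \<forall>u. norm u \<le> 1 \<longrightarrow> f (blinfun_apply q u) = f (blinfun_apply g u)}"
    proof -
      have "{q. \<forall>u. norm u \<le> 1 \<longrightarrow> f (blinfun_apply q u) = f (blinfun_apply g u)} =
          (\<Inter>u\<in>cball 0 1. {q. f (blinfun_apply q u) = f (blinfun_apply g u)})" by auto
      moreover have "continuous_on UNIV (\<lambda>q. f (blinfun_apply q u))" for u
        by (rule continuous_on_compose2[OF f]) (auto intro: continuous_intros)
      ultimately show ?thesis
        by (auto intro!: closed_INT closed_Collect_eq continuous_on_const)
    qed
    then have "compact ?C" by (intro compact_Int_closed compact_orth_blinfuns)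
    have "?C \<noteq> {}" using g by auto
    obtain q where q: "q \<in> ?C" and min: "\<And>q'. q' \<in> ?C \<Longrightarrow> norm (q - id_blinfun) \<le> norm (q' - id_blinfun)"
    proof -
      have "continuous_on ?C (\<lambda>q. norm (q - id_blinfun))" by (intro continuous_intros)
      from continuous_attains_inf[OF \<open>compact ?C\<close> \<open>?C \<noteq> {}\<close> this] show ?thesis using that by blast
    qed
    have "P n q e"
      unfolding P_def
    proof (intro conjI ballI impI)
      fix h :: "'a \<Rightarrow>\<^sub>L 'a"
      assume h: "h \<in> orth_blinfuns" "\<forall>u. norm u \<le> 1 \<longrightarrow> f (blinfun_apply h u) = f u"
      have "h o\<^sub>L q \<in> ?C"
        using q h by (simp add: orth_blinfun_compose norm_orth_blinfun)
      then show "norm (q - id_blinfun) \<le> norm ((h o\<^sub>L q) - id_blinfun)" by (rule min)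
    qed (use q e far[of q] in auto)
    then show ?thesis by blast
  qed
  then obtain q e where P: "\<And>n. P n (q n) (e n)" by metis
  define t where "t = (\<lambda>n. norm (q n - id_blinfun))"
  have qo: "q n \<in> orth_blinfuns" and qe: "\<And>u. norm u \<le> 1 \<Longrightarrow> \<bar>f (blinfun_apply (q n) u) - f u\<bar> \<le> e n"
    and et: "real (Suc n) * e n < t n"
    and min: "\<And>h. h \<in> orth_blinfuns \<Longrightarrow> (\<And>u. norm u \<le> 1 \<Longrightarrow> f (blinfun_apply h u) = f u) \<Longrightarrow> t n \<le> norm ((h o\<^sub>L q n) - id_blinfun)" for n
    using P[of n] unfolding P_def t_def by blast+
  have e0: "0 \<le> e n" for n using qe[of 0 n] by simp
  have t0: "0 < t n" for n using et[of n] e0[of n]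
    by (smt (verit) mult_nonneg_nonneg of_nat_0_le_iff)
  have t2: "t n \<le> 2" for n
    using onorm_orth_blinfun_le[OF qo[of n]] norm_triangle_ineq4[of "q n" id_blinfun]
      onorm_orth_blinfun_le[OF orth_blinfun_id, where 'a='a]
    unfolding t_def by linarith
  have en: "e n \<le> t n / Suc n" for n using et[of n] by (simp add: field_simps)
  have elim: "e \<longlonglongrightarrow> 0"
  proof (rule tendsto_sandwich[OF _ _ tendsto_const])
    show "\<forall>\<^sub>F n in sequentially. 0 \<le> e n" using e0 by simp
    show "\<forall>\<^sub>F n in sequentially. e n \<le> 2 * inverse (Suc n)"
    proof (intro always_eventually allI)
      show "e n \<le> 2 * inverse (Suc n)" for n
        using en[of n] t2[of n] by (simp add: field_simps)
    qed
    show "(\<lambda>n. 2 * inverse (real (Suc n))) \<longlonglongrightarrow> 0"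
      using tendsto_mult_right_zero[OF LIMSEQ_inverse_real_of_nat] by blast
  qed
  \<comment> \<open>A limit \<open>g\<close> of the elements stabilises \<open>f\<close>. Composing
    with its inverse makes the displacement tend to \<open>0\<close>, so by minimality
    \<open>t\<close> itself tends to \<open>0\<close> along \<open>r1\<close>.\<close>
  obtain g r1 where g: "strict_mono r1" "(q \<circ> r1) \<longlonglongrightarrow> g"
    using compact_orth_blinfuns qo unfolding compact_def by metis
  have gs: "g \<in> orth_blinfuns" "\<And>u. norm u \<le> 1 \<Longrightarrow> f (blinfun_apply g u) = f u"
    using stabiliser_limit[OF f g(2), of "e \<circ> r1"] qo qe LIMSEQ_subseq_LIMSEQ[OF elim g(1)] by auto
  obtain g' where g': "g' \<in> orth_blinfuns" "g o\<^sub>L g' = id_blinfun" "g' o\<^sub>L g = id_blinfun"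
    by (rule orth_blinfun_inverse[OF gs(1)])
  have inv_stab: "f (blinfun_apply h' u) = f u"
    if "h' \<in> orth_blinfuns" "h o\<^sub>L h' = id_blinfun" "\<And>u. norm u \<le> 1 \<Longrightarrow> f (blinfun_apply h u) = f u" "norm u \<le> 1" for h h' u
  proof -
    have "h (h' u) = u" using that(2) by (metis blinfun_apply_blinfun_compose blinfun_apply_id_blinfun id_apply)
    then show ?thesis using that(3)[of "h' u"] that by (simp add: norm_orth_blinfun)
  qed
  have "(\<lambda>n. norm ((g' o\<^sub>L (q \<circ> r1) n) - id_blinfun)) \<longlonglongrightarrow> norm ((g' o\<^sub>L g) - id_blinfun)"
    by (intro tendsto_intros bounded_bilinear.tendsto[OF bounded_bilinear_blinfun_compose] g)
  then have "(\<lambda>n. norm ((g' o\<^sub>L (q \<circ> r1) n) - id_blinfun)) \<longlonglongrightarrow> 0" using g' by simp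
  then have tlim1: "(t \<circ> r1) \<longlonglongrightarrow> 0"
    by (rule tendsto_sandwich[OF _ _ tendsto_const, rotated 2])
      (use t0 min[OF g'(1) inv_stab[OF g'(1,2) gs(2)]] in \<open>auto simp: less_imp_le\<close>)
  \<comment> \<open>Displacements scaled to norm \<open>1\<close>; their limit \<open>A0\<close>
    acts as a tangent vector of the stabiliser at the identity.\<close>
  define A where "A = (\<lambda>n. (q n - id_blinfun) /\<^sub>R t n)"
  have nA: "norm (A n) = 1" for n using t0[of n] unfolding A_def by (simp add: t_def)
  have qA: "q n - id_blinfun = t n *\<^sub>R A n" for n using t0[of n] unfolding A_def by simp
  have "compact (sphere (0::'a \<Rightarrow>\<^sub>L 'a) 1)"
  proof -
    have "bounded (sphere (0::'a \<Rightarrow>\<^sub>L 'a) 1)" by (rule boundedI[of _ 1]) simp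
    moreover have "closed (sphere (0::'a \<Rightarrow>\<^sub>L 'a) 1)"
      unfolding sphere_def by (intro closed_Collect_eq continuous_intros)
    ultimately show ?thesis by (simp add: compact_eq_bounded_closed)
  qed
  moreover have "\<forall>n. (A \<circ> r1) n \<in> sphere 0 1" by (simp add: nA)
  ultimately obtain A0 r2 where A0: "strict_mono r2" "(A \<circ> r1 \<circ> r2) \<longlonglongrightarrow> A0"
    unfolding compact_def by metis
  define r where "r = r1 \<circ> r2"
  have r: "strict_mono r" unfolding r_def using g(1) A0(1) by (rule strict_mono_o)
  have Alim: "(\<lambda>n. A (r n)) \<longlonglongrightarrow> A0" using A0 by (simp add: r_def o_def)
  have tlim: "(\<lambda>n. t (r n)) \<longlonglongrightarrow> 0"
    using LIMSEQ_subseq_LIMSEQ[OF tlim1 A0(1)] by (simp add: r_def o_def)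
  \<comment> \<open>About \<open>s / t\<close> iterations of a short element travel a distance of
    about \<open>s\<close> in direction \<open>A0\<close>, while the defect of invariance stays
    below \<open>s / Suc n\<close>. In the limit this gives an exact stabiliser element.\<close>
  have one_param: "\<exists>h\<in>orth_blinfuns. (\<forall>u. norm u \<le> 1 \<longrightarrow> f (blinfun_apply h u) = f u) \<and>
      norm (h - id_blinfun - s *\<^sub>R A0) \<le> s\<^sup>2" if s: "0 < s" for s
  proof -
    define k where "k = (\<lambda>n. nat \<lfloor>s / t (r n)\<rfloor>)"
    have kle: "k n * t (r n) \<le> s" for n
    proof -
      have "real (k n) \<le> s / t (r n)" unfolding k_def using s t0[of "r n"] by simp
      then show ?thesis using t0[of "r n"] by (simp add: field_simps)
    qed
    have kge: "s - t (r n) \<le> k n * t (r n)" for n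
    proof -
      have "s / t (r n) - 1 \<le> real (k n)" unfolding k_def by linarith
      then show ?thesis using t0[of "r n"] by (simp add: field_simps)
    qed
    have klim: "(\<lambda>n. k n * t (r n)) \<longlonglongrightarrow> s"
    proof (rule tendsto_sandwich)
      show "(\<lambda>n. s - t (r n)) \<longlonglongrightarrow> s" using tendsto_diff[OF tendsto_const tlim, of s] by simp
      show "(\<lambda>n. s) \<longlonglongrightarrow> s" by simp
    qed (use kle kge in auto)
    define b where "b = (\<lambda>n. blinfun_power (q (r n)) (k n))"
    have bo: "b n \<in> orth_blinfuns" for n unfolding b_def by (rule orth_blinfun_power[OF qo])
    obtain h r3 where h: "strict_mono r3" "(b \<circ> r3) \<longlonglongrightarrow> h"
      using compact_orth_blinfuns bo unfolding compact_def by metis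
    have be: "\<bar>f (blinfun_apply (b n) u) - f u\<bar> \<le> s * inverse (Suc n)" if "norm u \<le> 1" for n u
    proof -
      have "n \<le> r n" by (rule seq_suble[OF r])
      have "\<bar>f (blinfun_apply (b n) u) - f u\<bar> \<le> k n * e (r n)"
        unfolding b_def by (rule orbit_power_bound[where f=f, OF qo qe that])
      also have "\<dots> \<le> k n * (t (r n) / Suc (r n))" by (intro mult_left_mono en) auto
      also have "\<dots> \<le> s / Suc (r n)" using kle[of n] by (simp add: divide_right_mono)
      also have "\<dots> \<le> s / Suc n" using s \<open>n \<le> r n\<close> by (intro divide_left_mono) auto
      finally show ?thesis by (simp add: divide_inverse)
    qed
    have "(\<lambda>n. s * inverse (real (Suc n))) \<longlonglongrightarrow> 0"
      using tendsto_mult_right_zero[OF LIMSEQ_inverse_real_of_nat] by blast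
    from LIMSEQ_subseq_LIMSEQ[OF this h(1)]
    have hs: "h \<in> orth_blinfuns" "\<And>u. norm u \<le> 1 \<Longrightarrow> f (blinfun_apply h u) = f u"
      using stabiliser_limit[OF f h(2), of "(\<lambda>n. s * inverse (Suc n)) \<circ> r3"] bo be by auto
    have "norm (b n - id_blinfun - (k n * t (r n)) *\<^sub>R A (r n)) \<le> s\<^sup>2" for n
    proof -
      have "norm (b n - id_blinfun - k n *\<^sub>R (q (r n) - id_blinfun)) \<le> (k n * t (r n))\<^sup>2"
        unfolding b_def t_def by (rule blinfun_power_linearisation[OF qo])
      also have "\<dots> \<le> s\<^sup>2" using kle t0[of "r n"] by (intro power_mono) auto
      finally show ?thesis by (simp add: qA)
    qed
    moreover have "(\<lambda>n. norm ((b \<circ> r3) n - id_blinfun - ((\<lambda>n. k n * t (r n)) \<circ> r3) n *\<^sub>R ((\<lambda>n. A (r n)) \<circ> r3) n))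
        \<longlonglongrightarrow> norm (h - id_blinfun - s *\<^sub>R A0)"
      by (intro tendsto_intros h(2) LIMSEQ_subseq_LIMSEQ[OF klim h(1)] LIMSEQ_subseq_LIMSEQ[OF Alim h(1)])
    ultimately have "norm (h - id_blinfun - s *\<^sub>R A0) \<le> s\<^sup>2"
      by (intro LIMSEQ_le_const2) (auto simp: o_def)
    with hs show ?thesis by blast
  qed
  have "\<forall>\<^sub>F n in sequentially. norm (A (r n) - A0) < 1/4 \<and> t (r n) < 1/4"
    using tendstoD[OF Alim, of "1/4"] order_tendstoD(2)[OF tlim, of "1/4"]
    by (auto simp: dist_norm eventually_conj_iff)
  from eventually_happens'[OF sequentially_bot this]
  obtain n where n: "norm (A (r n) - A0) < 1/4" "t (r n) < 1/4" by blast
  \<comment> \<open>With the bounds \<open>1/4\<close>, both \<open>s * norm (A (r n) - A0)\<close>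
    and the square of \<open>s\<close> are at most \<open>s / 4\<close>. Removing \<open>h\<close>
    from \<open>q (r n)\<close> then leaves a displacement of at most \<open>s / 2\<close>, contrary
    to minimality.\<close>
  define s where "s = t (r n)"
  have s: "0 < s" "s < 1/4" using t0 n by (auto simp: s_def)
  obtain h where h: "h \<in> orth_blinfuns" "\<And>u. norm u \<le> 1 \<Longrightarrow> f (blinfun_apply h u) = f u"
      "norm (h - id_blinfun - s *\<^sub>R A0) \<le> s\<^sup>2"
    using one_param[OF s(1)] by blast
  obtain h' where h': "h' \<in> orth_blinfuns" "h o\<^sub>L h' = id_blinfun" "h' o\<^sub>L h = id_blinfun"
    by (rule orth_blinfun_inverse[OF h(1)])
  have "s \<le> norm ((h' o\<^sub>L q (r n)) - id_blinfun)"
    unfolding s_def by (rule min[OF h'(1) inv_stab[OF h'(1,2) h(2)]])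
  also have "(h' o\<^sub>L q (r n)) - id_blinfun = h' o\<^sub>L (q (r n) - h)"
    using h' by (simp add: blinfun_compose_diff_right)
  also have "norm \<dots> \<le> 1 * norm (q (r n) - h)"
    using onorm_orth_blinfun_le[OF h'(1)] by (meson norm_blinfun_compose mult_right_mono norm_ge_zero order_trans)
  also have "q (r n) - h = s *\<^sub>R (A (r n) - A0) - (h - id_blinfun - s *\<^sub>R A0)"
    using qA[of "r n"] by (simp add: s_def algebra_simps)
  also have "1 * norm \<dots> \<le> s * norm (A (r n) - A0) + s\<^sup>2"
    using norm_triangle_ineq4[of "s *\<^sub>R (A (r n) - A0)" "h - id_blinfun - s *\<^sub>R A0"] h(3) s by simp
  also have "\<dots> \<le> s * (1/4) + s * (1/4)"
    using s n unfolding power2_eq_square by (intro add_mono mult_left_mono) auto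
  finally show False using s by simp
qed

section \<open>Fields of congruent seminorms on tangent spaces\<close>

text \<open>By compactness finitely many constant choices \<open>u\<close> suffice, and the
  normalised positive parts of \<open>\<Psi> u z\<close> form a partition of unity. At each
  \<open>z\<close> only admissible \<open>u\<close> receive weight, so convexity keeps the average
  admissible.\<close>

lemma continuous_convex_selection:
  fixes \<Psi> :: "'e::real_normed_vector \<Rightarrow> 'b::topological_space \<Rightarrow> real"
  assumes X: "compact X" and cont: "\<And>u. continuous_on X (\<Psi> u)"
    and ex: "\<And>z. z \<in> X \<Longrightarrow> \<exists>u. \<Psi> u z > 0"
    and conv: "\<And>z. z \<in> X \<Longrightarrow> convex {u. \<Psi> u z > 0}"
  shows "\<exists>a. continuous_on X a \<and> (\<forall>z\<in>X. \<Psi> (a z) z > 0)"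
proof -
  have "\<exists>U. open U \<and> U \<inter> X = {z\<in>X. \<Psi> u z > 0}" for u
  proof -
    obtain A where "open A" "A \<inter> X = \<Psi> u -` {0<..} \<inter> X"
      using cont[of u] open_greaterThan[of "0::real"] unfolding continuous_on_open_invariant by blast
    then show ?thesis by (intro exI[of _ A]) auto
  qed
  then obtain U where U: "\<And>u. open (U u)" "\<And>u. U u \<inter> X = {z\<in>X. \<Psi> u z > 0}" by metis
  have "X \<subseteq> (\<Union>u\<in>UNIV. U u)" using ex U(2) by blast
  then obtain T where T: "finite T" "X \<subseteq> (\<Union>u\<in>T. U u)"
    using compactE_image[OF X, of UNIV U] U(1) by metis
  define w where "w = (\<lambda>u z. max 0 (\<Psi> u z))"
  define s where "s = (\<lambda>z. \<Sum>u\<in>T. w u z)"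
  have w: "continuous_on X (w u)" for u unfolding w_def by (intro continuous_intros cont)
  have s: "s z > 0" if "z \<in> X" for z
  proof -
    obtain u where "u \<in> T" "\<Psi> u z > 0" using T(2) U(2) \<open>z \<in> X\<close> by blast
    then have "0 < w u z" by (simp add: w_def)
    also have "w u z \<le> s z" unfolding s_def
      by (rule member_le_sum) (use \<open>u \<in> T\<close> T in \<open>auto simp: w_def\<close>)
    finally show ?thesis .
  qed
  define a where "a = (\<lambda>z. \<Sum>u\<in>T. (w u z / s z) *\<^sub>R u)"
  show ?thesis
  proof (intro exI conjI ballI)
    show "continuous_on X a"
      unfolding a_def using s by (intro continuous_intros w) (auto simp: s_def intro!: continuous_intros w, force)
    fix z assume z: "z \<in> X"
    let ?T = "{u\<in>T. \<Psi> u z > 0}"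
    have zero: "w u z = 0" if "u \<in> T - ?T" for u using that by (auto simp: w_def)
    have "a z = (\<Sum>u\<in>?T. (w u z / s z) *\<^sub>R u)"
      unfolding a_def by (rule sum.mono_neutral_right) (use T zero in auto)
    also have "\<dots> \<in> {u. \<Psi> u z > 0}"
    proof (rule convex_sum[OF _ conv[OF z]])
      have "(\<Sum>u\<in>?T. w u z) = s z"
        unfolding s_def by (rule sum.mono_neutral_left) (use T zero in auto)
      then show "(\<Sum>u\<in>?T. w u z / s z) = 1" using s[OF z] by (simp flip: sum_divide_distrib)
    qed (use T s[OF z] in \<open>auto simp: w_def\<close>)
    finally show "\<Psi> (a z) z > 0" by simp
  qed
qed

lemma norm_normalize_diff_le:
  fixes a b :: "'a::real_normed_vector"
  assumes "a \<noteq> 0" "b \<noteq> 0"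
  shows "norm (a /\<^sub>R norm a - b /\<^sub>R norm b) \<le> 2 * norm (a - b) / norm a"
proof -
  have e: "a /\<^sub>R norm a - b /\<^sub>R norm b = (a - b) /\<^sub>R norm a + (inverse (norm a) - inverse (norm b)) *\<^sub>R b"
    by (simp add: algebra_simps)
  have i: "inverse (norm a) - inverse (norm b) = (norm b - norm a) / (norm a * norm b)"
    using assms by (simp add: field_simps)
  have "norm ((inverse (norm a) - inverse (norm b)) *\<^sub>R b) = \<bar>norm b - norm a\<bar> / norm a"
    unfolding i using assms by (simp add: abs_mult)
  also have "\<dots> \<le> norm (a - b) / norm a"
    using norm_triangle_ineq3[of b a] by (intro divide_right_mono) (auto simp: norm_minus_commute)
  finally have "norm ((inverse (norm a) - inverse (norm b)) *\<^sub>R b) \<le> norm (a - b) / norm a" .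
  moreover have "norm ((a - b) /\<^sub>R norm a) = norm (a - b) / norm a" by (simp add: divide_inverse_commute)
  ultimately show ?thesis unfolding e
    by (smt (verit) norm_triangle_ineq add_divide_distrib)
qed

text \<open>Seminorms on tangent spaces, extended to the whole space by being constant along
  \<open>x\<close>; this gives the seminorms at different base points a common domain, on which
  \<open>lipschitz\<close> can compare them.\<close>

locale congruent_seminorm_field =
  fixes h :: "real ^ 'n \<Rightarrow> real ^ 'n \<Rightarrow> real" and M \<Lambda> :: real
  assumes subadd: "norm x = 1 \<Longrightarrow> h x (u + v) \<le> h x u + h x v"
    and homog: "norm x = 1 \<Longrightarrow> c \<ge> 0 \<Longrightarrow> h x (c *\<^sub>R u) = c * h x u"
    and tangential: "norm x = 1 \<Longrightarrow> h x (u + s *\<^sub>R x) = h x u"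
    and even: "norm x = 1 \<Longrightarrow> h x (- u) = h x u"
    and bounded: "norm x = 1 \<Longrightarrow> h x u \<le> M * norm u"
    and lipschitz: "norm x = 1 \<Longrightarrow> norm y = 1 \<Longrightarrow> \<bar>h x u - h y u\<bar> \<le> \<Lambda> * norm (x - y) * norm u"
    and cong: "norm x = 1 \<Longrightarrow> norm y = 1 \<Longrightarrow>
      \<exists>g\<in>orth_blinfuns. blinfun_apply g x = y \<and> (\<forall>u. h y (blinfun_apply g u) = h x u)"
begin

lemma nonneg: "norm x = 1 \<Longrightarrow> 0 \<le> h x u"
  using subadd[of x u "- u"] homog[of x 0 0] even[of x u] by simp

lemma exists_unit: "\<exists>x::real^'n. norm x = 1"
  using vector_choose_size[of 1] by auto

lemma M_nonneg: "0 \<le> M"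
proof -
  obtain x :: "real^'n" where x: "norm x = 1" using exists_unit by blast
  show ?thesis using nonneg[OF x, of x] bounded[OF x, of x] x by simp
qed

lemma \<Lambda>_nonneg: "0 \<le> \<Lambda>"
proof -
  obtain x :: "real^'n" where x: "norm x = 1" using exists_unit by blast
  then have "norm (-x) = 1" by simp
  note l = lipschitz[OF x this, of x]
  have "norm (x - - x) = 2" using x by (simp flip: scaleR_2)
  then have "\<bar>h x x - h (- x) x\<bar> \<le> \<Lambda> * 2" using l x by simp
  then have "0 \<le> \<Lambda> * 2" by (rule order_trans[OF abs_ge_zero])
  then show ?thesis by simp
qed

lemma lipschitz_right: "norm x = 1 \<Longrightarrow> \<bar>h x u - h x v\<bar> \<le> M * norm (u - v)"
  using subadd[of x v "u - v"] subadd[of x u "v - u"] bounded[of x "u - v"] bounded[of x "v - u"]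
  by (simp add: norm_minus_commute)

lemma continuous_right: "norm x = 1 \<Longrightarrow> continuous_on UNIV (h x)"
  unfolding continuous_on_iff
proof (intro ballI allI impI)
  fix u and e :: real assume x: "norm x = 1" and "0 < e"
  show "\<exists>d>0. \<forall>v\<in>UNIV. dist v u < d \<longrightarrow> dist (h x v) (h x u) < e"
  proof (intro exI conjI ballI impI)
    show "0 < e / (M + 1)" using \<open>0 < e\<close> M_nonneg by simp
    fix v assume "dist v u < e / (M + 1)"
    then have "(M + 1) * norm (v - u) < e" using M_nonneg by (simp add: dist_norm field_simps)
    moreover have "M * norm (v - u) \<le> (M + 1) * norm (v - u)" by (simp add: mult_right_mono)
    ultimately show "dist (h x v) (h x u) < e"
      using lipschitz_right[OF x, of v u] by (simp add: dist_real_def)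
  qed
qed

lemma continuous_left: "continuous_on (sphere 0 1) (\<lambda>x. h x u)"
  unfolding continuous_on_iff
proof (intro ballI allI impI)
  fix x :: "real^'n" and e :: real assume x: "x \<in> sphere 0 1" and "0 < e"
  let ?L = "\<Lambda> * norm u"
  have L: "0 \<le> ?L" using \<Lambda>_nonneg by simp
  show "\<exists>d>0. \<forall>y\<in>sphere 0 1. dist y x < d \<longrightarrow> dist (h y u) (h x u) < e"
  proof (intro exI conjI ballI impI)
    show "0 < e / (?L + 1)" using \<open>0 < e\<close> L by simp
    fix y :: "real^'n" assume y: "y \<in> sphere 0 1" "dist y x < e / (?L + 1)"
    then have "(?L + 1) * norm (y - x) < e" using L by (simp add: dist_norm field_simps)
    moreover have "?L * norm (y - x) \<le> (?L + 1) * norm (y - x)" by (simp add: mult_right_mono)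
    ultimately show "dist (h y u) (h x u) < e"
      using lipschitz[of y x u] x y by (simp add: dist_real_def mult_ac)
  qed
qed

text \<open>Adding \<open>x \<bullet> u\<close> to the even function \<open>h x u\<close> encodes the base point \<open>x\<close> as the odd part, so that a
  congruence matching the sums also matches base points.\<close>

lemma near_identity_congruence:
  "\<exists>C>0. \<forall>x y. norm x = 1 \<longrightarrow> norm y = 1 \<longrightarrow>
     (\<exists>g\<in>orth_blinfuns. blinfun_apply g x = y \<and> (\<forall>u. norm u \<le> 1 \<longrightarrow> h y (blinfun_apply g u) = h x u) \<and>
        norm (g - id_blinfun) \<le> C * norm (x - y))"
proof -
  obtain e :: "real^'n" where e: "norm e = 1" using exists_unit by blast
  define F where "F = (\<lambda>x u. h x u + x \<bullet> u)"
  have "continuous_on UNIV (F e)"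
    unfolding F_def by (intro continuous_intros continuous_right e)
  from orbit_displacement[OF this] obtain C where C: "C > 0" and
    C': "\<And>g d. g \<in> orth_blinfuns \<Longrightarrow> (\<And>u. norm u \<le> 1 \<Longrightarrow> \<bar>F e (blinfun_apply g u) - F e u\<bar> \<le> d) \<Longrightarrow>
      \<exists>q\<in>orth_blinfuns. (\<forall>u. norm u \<le> 1 \<longrightarrow> F e (blinfun_apply q u) = F e (blinfun_apply g u)) \<and>
       norm (q - id_blinfun) \<le> C * d" by blast
  have F_cong: "F y (blinfun_apply g u) = F x u"
    if "g \<in> orth_blinfuns" "blinfun_apply g x = y" "\<forall>u. h y (blinfun_apply g u) = h x u" for g x y u
    using orth_blinfun_inner[OF that(1), of x u] that(2,3) by (simp add: F_def)
  show ?thesis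
  proof (intro exI[of _ "C * (\<Lambda> + 1)"] conjI allI impI)
    show "0 < C * (\<Lambda> + 1)" using C \<Lambda>_nonneg by simp
    fix x y :: "real^'n" assume x: "norm x = 1" and y: "norm y = 1"
    obtain a where a: "a \<in> orth_blinfuns" "blinfun_apply a e = x" "\<forall>u. h x (blinfun_apply a u) = h e u"
      using cong[OF e x] by blast
    obtain b where b: "b \<in> orth_blinfuns" "blinfun_apply b e = y" "\<forall>u. h y (blinfun_apply b u) = h e u"
      using cong[OF e y] by blast
    obtain a' where a': "a' \<in> orth_blinfuns" "a o\<^sub>L a' = id_blinfun" "a' o\<^sub>L a = id_blinfun"
      by (rule orth_blinfun_inverse[OF a(1)])
    obtain b' where b': "b' \<in> orth_blinfuns" "b o\<^sub>L b' = id_blinfun" "b' o\<^sub>L b = id_blinfun"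
      by (rule orth_blinfun_inverse[OF b(1)])
    have aa': "blinfun_apply a (blinfun_apply a' u) = u" and bb': "blinfun_apply b (blinfun_apply b' u) = u" for u
      using a'(2) b'(2) by (metis blinfun_apply_blinfun_compose blinfun_apply_id_blinfun id_apply)+
    \<comment> \<open>On \<open>F e\<close>, the map \<open>a' o\<^sub>L b\<close> acts with a
      defect equal to the difference of \<open>F x\<close> and \<open>F y\<close>, which is small;
      so the orbit estimate applies to it.\<close>
    have "\<bar>F e (blinfun_apply (a' o\<^sub>L b) u) - F e u\<bar> \<le> (\<Lambda> + 1) * norm (x - y)" if u: "norm u \<le> 1" for u
    proof -
      let ?w = "blinfun_apply b u"
      have "F e (blinfun_apply (a' o\<^sub>L b) u) = F x ?w"
        using F_cong[OF a, of "blinfun_apply a' ?w"] by (simp add: aa')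
      moreover have "F e u = F y ?w" using F_cong[OF b] by simp
      moreover have "\<bar>F x ?w - F y ?w\<bar> \<le> \<bar>h x ?w - h y ?w\<bar> + \<bar>(x - y) \<bullet> ?w\<bar>"
        by (simp add: F_def inner_diff_left)
      moreover have "norm ?w \<le> 1" using u b by (simp add: norm_orth_blinfun)
      moreover have "\<bar>h x ?w - h y ?w\<bar> \<le> \<Lambda> * norm (x - y) * norm ?w" by (rule lipschitz[OF x y])
      moreover have "\<bar>(x - y) \<bullet> ?w\<bar> \<le> norm (x - y) * norm ?w" by (rule Cauchy_Schwarz_ineq2)
      moreover have "(\<Lambda> * norm (x - y) + norm (x - y)) * norm ?w \<le> \<Lambda> * norm (x - y) + norm (x - y)"
        using \<open>norm ?w \<le> 1\<close> \<Lambda>_nonneg by (intro mult_left_le) auto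
      ultimately show ?thesis by (simp add: algebra_simps)
    qed
    then obtain q where q: "q \<in> orth_blinfuns" "norm (q - id_blinfun) \<le> C * ((\<Lambda> + 1) * norm (x - y))"
      "\<And>u. norm u \<le> 1 \<Longrightarrow> F e (blinfun_apply q u) = F e (blinfun_apply (a' o\<^sub>L b) u)"
      using C'[OF orth_blinfun_compose[OF a'(1) b(1)]] by blast
    \<comment> \<open>Conjugation by \<open>b\<close> moves \<open>q\<close> from \<open>e\<close>
      to \<open>y\<close> without enlarging its displacement. As \<open>q\<close> acts on
      \<open>F e\<close> like \<open>a' o\<^sub>L b\<close>, the factor \<open>b\<close> cancels
      against \<open>b'\<close> and a congruence from \<open>x\<close> to \<open>y\<close>
      remains.\<close>
    define g where "g = b o\<^sub>L (q o\<^sub>L b')"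
    have g: "g \<in> orth_blinfuns" unfolding g_def by (intro orth_blinfun_compose b q b')
    have Fg: "F y (blinfun_apply g u) = F x u" if "norm u \<le> 1" for u
    proof -
      let ?w = "blinfun_apply b' u"
      have w: "norm ?w \<le> 1" using that b' by (simp add: norm_orth_blinfun)
      have "F y (blinfun_apply g u) = F e (blinfun_apply q ?w)" unfolding g_def using F_cong[OF b] by simp
      also have "\<dots> = F e (blinfun_apply a' u)" using q(3)[OF w] by (simp add: bb')
      also have "\<dots> = F x u" using F_cong[OF a, of "blinfun_apply a' u"] by (simp add: aa')
      finally show ?thesis .
    qed
    show "\<exists>g\<in>orth_blinfuns. blinfun_apply g x = y \<and> (\<forall>u. norm u \<le> 1 \<longrightarrow> h y (blinfun_apply g u) = h x u) \<and>
        norm (g - id_blinfun) \<le> C * (\<Lambda> + 1) * norm (x - y)"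
    proof (intro bexI[OF _ g] conjI allI impI)
      fix u :: "real^'n" assume u: "norm u \<le> 1"
      have p: "F y (blinfun_apply g u) = F x u" "F y (- blinfun_apply g u) = F x (- u)"
        using Fg[of u] Fg[of "-u"] u by (simp_all add: blinfun.minus_right)
      then show "h y (blinfun_apply g u) = h x u"
        unfolding F_def even[OF x] even[OF y] by simp
    next
      have "F y (blinfun_apply g x) = F x x" "F y (- blinfun_apply g x) = F x (- x)"
        using Fg[of x] Fg[of "-x"] x by (simp_all add: blinfun.minus_right)
      then have "y \<bullet> blinfun_apply g x = x \<bullet> x"
        unfolding F_def even[OF x] even[OF y] by simp
      then have "y \<bullet> blinfun_apply g x = norm y * norm (blinfun_apply g x)"
        using x y g by (simp add: norm_orth_blinfun) (simp add: norm_eq_1)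
      then show "blinfun_apply g x = y"
        using x y g norm_cauchy_schwarz_eq[of y "blinfun_apply g x"] by (simp add: norm_orth_blinfun)
    next
      have "g - id_blinfun = b o\<^sub>L ((q - id_blinfun) o\<^sub>L b')"
        unfolding g_def using bb'
        by (intro blinfun_eqI) (simp add: blinfun.diff_left blinfun.diff_right)
      also have "norm \<dots> \<le> norm b * (norm (q - id_blinfun) * norm b')"
        by (meson norm_blinfun_compose mult_left_mono norm_ge_zero order_trans)
      also have "\<dots> \<le> 1 * (norm (q - id_blinfun) * 1)"
        using onorm_orth_blinfun_le[OF b(1)] onorm_orth_blinfun_le[OF b'(1)]
        by (intro mult_mono mult_left_mono) auto
      finally show "norm (g - id_blinfun) \<le> C * (\<Lambda> + 1) * norm (x - y)" using q(2) by (simp add: mult_ac)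
    qed
  qed
qed


text \<open>Averaging nearby congruent copies of \<open>v z\<close> costs only \<open>O(d\<^sup>2)\<close>: \<open>h\<close> is convex, and averages of unit vectors
  within distance \<open>O(d)\<close> of each other are shorter than unit length by only \<open>O(d\<^sup>2)\<close>. Hence the total
  error of \<open>O(1/d)\<close> consecutive steps is \<open>O(d)\<close>.\<close>

lemma transport_step:
  "\<exists>Q>0. \<exists>d0>0. \<forall>(X::(real^'n) set) p p' v c d.
     compact X \<and> continuous_on X p \<and> continuous_on X p' \<and> continuous_on X v \<and>
     (\<forall>z\<in>X. norm (p z) = 1 \<and> norm (p' z) = 1 \<and> norm (v z) = 1 \<and> v z \<bullet> p z = 0 \<and>
        h (p z) (v z) \<le> c \<and> norm (p z - p' z) \<le> d) \<and> 0 \<le> c \<and> 0 < d \<and> d \<le> d0 \<longrightarrow>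
     (\<exists>v'. continuous_on X v' \<and> (\<forall>z\<in>X. norm (v' z) = 1 \<and> v' z \<bullet> p' z = 0 \<and> h (p' z) (v' z) \<le> c + Q * d\<^sup>2))"
proof -
  obtain C where C: "C > 0" and near: "\<And>x y. norm x = 1 \<Longrightarrow> norm y = 1 \<Longrightarrow>
     \<exists>g\<in>orth_blinfuns. blinfun_apply g x = y \<and> (\<forall>u. norm u \<le> 1 \<longrightarrow> h y (blinfun_apply g u) = h x u) \<and>
        norm (g - id_blinfun) \<le> C * norm (x - y)"
    using near_identity_congruence by blast
  define B where "B = C\<^sup>2"
  have B: "B > 0" using C by (simp add: B_def)
  \<comment> \<open>\<open>Q\<close> collects the losses of one step: the tolerance
    \<open>d\<^sup>2\<close>, and the division by \<open>1 - (B + 1) * d\<^sup>2\<close> of a value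
    of at most \<open>M + 1\<close>. \<open>d0\<close> keeps \<open>(B + 1) * d\<^sup>2\<close> at
    most \<open>1 / 2\<close>, where \<open>1 / (1 - y) \<le> 1 + 2 * y\<close> holds.\<close>
  define Q where "Q = 1 + 2 * (B + 1) * (M + 1)"
  define d0 where "d0 = min 1 (1 / (2 * (B + 1)))"
  have Q: "Q > 0" unfolding Q_def using B M_nonneg by (intro add_pos_nonneg) auto
  have d0: "d0 > 0" unfolding d0_def using B by simp
  have main: "\<exists>v'. continuous_on X v' \<and> (\<forall>z\<in>X. norm (v' z) = 1 \<and> v' z \<bullet> p' z = 0 \<and> h (p' z) (v' z) \<le> c + Q * d\<^sup>2)"
    if X: "compact X" and cp': "continuous_on X p'" and cv: "continuous_on X v"
      and z: "\<And>z. z \<in> X \<Longrightarrow> norm (p z) = 1" "\<And>z. z \<in> X \<Longrightarrow> norm (p' z) = 1" "\<And>z. z \<in> X \<Longrightarrow> norm (v z) = 1"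
        "\<And>z. z \<in> X \<Longrightarrow> v z \<bullet> p z = 0" "\<And>z. z \<in> X \<Longrightarrow> h (p z) (v z) \<le> c" "\<And>z. z \<in> X \<Longrightarrow> norm (p z - p' z) \<le> d"
      and c: "0 \<le> c" and d: "0 < d" "d \<le> d0" for X :: "(real^'n) set" and p p' v c d
  proof -
    \<comment> \<open>Truncation at \<open>M\<close> makes \<open>Q\<close> independent of
      \<open>c\<close>.\<close>
    define c' where "c' = min c M"
    have c': "0 \<le> c'" "c' \<le> M" "c' \<le> c" using c M_nonneg by (auto simp: c'_def)
    have hc': "h (p z) (v z) \<le> c'" if "z \<in> X" for z
      using z(5)[OF that] bounded[OF z(1)[OF that], of "v z"] z(3)[OF that] by (simp add: c'_def)
    \<comment> \<open>Three conditions on a candidate: close to \<open>v z\<close>, so that averages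
      keep almost unit length; seminorm almost at most \<open>c'\<close>; almost tangent at
      \<open>p' z\<close>. Tangency is relaxed so that a fixed candidate stays admissible for nearby
      \<open>z\<close>; the projection \<open>b\<close> restores it without changing the
      seminorm.\<close>
    define \<Psi> where "\<Psi> = (\<lambda>u z. min (u \<bullet> v z - (1 - B * d\<^sup>2)) (min (c' + d\<^sup>2 - h (p' z) u) (d\<^sup>2 - \<bar>u \<bullet> p' z\<bar>)))"
    have "\<exists>a. continuous_on X a \<and> (\<forall>z\<in>X. \<Psi> (a z) z > 0)"
    proof (rule continuous_convex_selection[OF X])
      fix u
      have "continuous_on X (\<lambda>z. h (p' z) u)"
        by (rule continuous_on_compose2[OF continuous_left cp']) (use z(2) in auto)
      then show "continuous_on X (\<Psi> u)"
        unfolding \<Psi>_def by (intro continuous_intros cv cp')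
    next
      fix y assume y: "y \<in> X"
      obtain g where g: "g \<in> orth_blinfuns" "blinfun_apply g (p y) = p' y"
          "\<And>u. norm u \<le> 1 \<Longrightarrow> h (p' y) (blinfun_apply g u) = h (p y) u"
          "norm (g - id_blinfun) \<le> C * norm (p y - p' y)"
        using near[OF z(1)[OF y] z(2)[OF y]] by blast
      let ?u = "blinfun_apply g (v y)"
      have nu: "norm ?u = 1" using g(1) z(3)[OF y] by (simp add: norm_orth_blinfun)
      have "?u \<bullet> p' y = v y \<bullet> p y" unfolding g(2)[symmetric] by (rule orth_blinfun_inner[OF g(1)])
      then have 3: "?u \<bullet> p' y = 0" using z(4)[OF y] by simp
      have 2: "h (p' y) ?u \<le> c'" using g(3)[of "v y"] z(3)[OF y] hc'[OF y] by simp
      have "norm (?u - v y) = norm (blinfun_apply (g - id_blinfun) (v y))" by (simp add: blinfun.diff_left)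
      also have "\<dots> \<le> norm (g - id_blinfun) * norm (v y)" by (rule norm_blinfun)
      also have "\<dots> \<le> C * d" using g(4) z(3)[OF y] z(6)[OF y] C
        by simp (meson mult_left_mono less_imp_le order_trans)
      finally have "(norm (?u - v y))\<^sup>2 \<le> (C * d)\<^sup>2" by (intro power_mono) auto
      \<comment> \<open>For unit vectors the inner product differs from \<open>1\<close> by half the
        squared distance: here the loss becomes quadratic in \<open>d\<close>.\<close>
      moreover have "(norm (?u - v y))\<^sup>2 = 2 - 2 * (?u \<bullet> v y)"
        using nu z(3)[OF y] by (simp add: power2_norm_eq_inner inner_diff_left inner_diff_right norm_eq_1 inner_commute)
      ultimately have "1 - B * d\<^sup>2 / 2 \<le> ?u \<bullet> v y" by (simp add: B_def power_mult_distrib)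
      moreover have "B * d\<^sup>2 > 0" using B d by simp
      ultimately have 1: "1 - B * d\<^sup>2 < ?u \<bullet> v y" by linarith
      show "\<exists>u. 0 < \<Psi> u y"
        unfolding \<Psi>_def by (rule exI[of _ ?u]) (use 1 2 3 d in \<open>simp add: add.commute add_strict_increasing\<close>)
    next
      fix y assume y: "y \<in> X"
      have "convex {u. h (p' y) u < c' + d\<^sup>2}"
        unfolding convex_def
      proof (intro ballI allI impI)
        fix a b and s t :: real
        assume ab: "a \<in> {u. h (p' y) u < c' + d\<^sup>2}" "b \<in> {u. h (p' y) u < c' + d\<^sup>2}" and st: "0 \<le> s" "0 \<le> t" "s + t = 1"
        have "h (p' y) (s *\<^sub>R a + t *\<^sub>R b) \<le> s * h (p' y) a + t * h (p' y) b"
          using subadd[OF z(2)[OF y], of "s *\<^sub>R a" "t *\<^sub>R b"] st by (simp add: homog[OF z(2)[OF y]])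
        also have "\<dots> < c' + d\<^sup>2" using convex_bound_lt[of "h (p' y) a" "c' + d\<^sup>2" "h (p' y) b" s t] ab st by simp
        finally show "s *\<^sub>R a + t *\<^sub>R b \<in> {u. h (p' y) u < c' + d\<^sup>2}" by simp
      qed
      moreover have "convex {u. u \<bullet> v y > 1 - B * d\<^sup>2}" "convex {u. u \<bullet> p' y > - d\<^sup>2}" "convex {u. u \<bullet> p' y < d\<^sup>2}"
        using convex_halfspace_gt[of "1 - B * d\<^sup>2" "v y"] convex_halfspace_gt[of "- d\<^sup>2" "p' y"]
          convex_halfspace_lt[of "p' y" "d\<^sup>2"] by (simp_all add: inner_commute)
      moreover have "{u. 0 < \<Psi> u y} = {u. u \<bullet> v y > 1 - B * d\<^sup>2} \<inter> {u. h (p' y) u < c' + d\<^sup>2} \<inter>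
          ({u. u \<bullet> p' y > - d\<^sup>2} \<inter> {u. u \<bullet> p' y < d\<^sup>2})"
        unfolding \<Psi>_def by (auto simp: abs_less_iff)
      ultimately show "convex {u. 0 < \<Psi> u y}" by (simp add: convex_Int)
    qed
    then obtain a where a: "continuous_on X a" "\<And>z. z \<in> X \<Longrightarrow> \<Psi> (a z) z > 0" by blast
    define b where "b = (\<lambda>z. a z - (a z \<bullet> p' z) *\<^sub>R p' z)"
    define \<kappa> where "\<kappa> = 1 - (B + 1) * d\<^sup>2"
    have dsq: "d\<^sup>2 \<le> d0" "d\<^sup>2 \<le> 1"
    proof -
      have d1: "d \<le> 1" using d by (auto simp: d0_def)
      then have "d * d \<le> 1 * d" using d by (intro mult_right_mono) auto
      then have "d\<^sup>2 \<le> d" by (simp only: power2_eq_square mult_1)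
      then show "d\<^sup>2 \<le> d0" "d\<^sup>2 \<le> 1" using d d1 by linarith+
    qed
    have half: "(B + 1) * d\<^sup>2 \<le> 1 / 2"
    proof -
      have "(B + 1) * d\<^sup>2 \<le> (B + 1) * (1 / (2 * (B + 1)))"
        using dsq B by (intro mult_left_mono) (auto simp: d0_def)
      also have "\<dots> = 1 / 2" using B by (simp add: field_simps)
      finally show ?thesis .
    qed
    have est: "norm (b y) \<ge> \<kappa>" "h (p' y) (b y) \<le> c' + d\<^sup>2" "b y \<bullet> p' y = 0" if y: "y \<in> X" for y
    proof -
      have A: "1 - B * d\<^sup>2 < a y \<bullet> v y" "h (p' y) (a y) < c' + d\<^sup>2" "\<bar>a y \<bullet> p' y\<bar> < d\<^sup>2"
        using a(2)[OF y] by (auto simp: \<Psi>_def)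
      have "a y \<bullet> v y \<le> norm (a y)" using norm_cauchy_schwarz[of "a y" "v y"] z(3)[OF y] by simp
      moreover have "norm (a y) \<le> norm (b y) + norm ((a y \<bullet> p' y) *\<^sub>R p' y)"
        unfolding b_def by (metis diff_add_cancel norm_triangle_ineq)
      ultimately show "norm (b y) \<ge> \<kappa>" using A(1,3) z(2)[OF y] by (simp add: \<kappa>_def algebra_simps)
      have "h (p' y) (b y) = h (p' y) (a y)"
        using tangential[OF z(2)[OF y], of "a y" "- (a y \<bullet> p' y)"] by (simp add: b_def)
      then show "h (p' y) (b y) \<le> c' + d\<^sup>2" using A(2) by simp
      show "b y \<bullet> p' y = 0" using z(2)[OF y] by (simp add: b_def inner_diff_left norm_eq_1)
    qed
    have \<kappa>: "\<kappa> \<ge> 1 / 2" using half by (simp add: \<kappa>_def)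
    have nb: "norm (b y) > 0" if "y \<in> X" for y using est(1)[OF that] \<kappa> by linarith
    have final: "(c' + d\<^sup>2) / \<kappa> \<le> c + Q * d\<^sup>2"
    proof -
      define y where "y = (B + 1) * d\<^sup>2"
      have y: "0 \<le> y" "y \<le> 1/2" using half B by (auto simp: y_def)
      have "1 \<le> (1 + 2 * y) * (1 - y)"
      proof -
        have "0 \<le> y * (1 - 2 * y)" using y by (intro mult_nonneg_nonneg) auto
        then show ?thesis by (simp add: algebra_simps)
      qed
      then have "(c' + d\<^sup>2) * 1 \<le> (c' + d\<^sup>2) * ((1 + 2 * y) * (1 - y))"
        using c' by (intro mult_left_mono) auto
      then have "(c' + d\<^sup>2) / \<kappa> \<le> (c' + d\<^sup>2) * (1 + 2 * y)"
        using \<kappa> by (simp add: \<kappa>_def y_def[symmetric] pos_divide_le_eq mult.assoc)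
      also have "\<dots> = c' + d\<^sup>2 + 2 * y * (c' + d\<^sup>2)" by (simp add: algebra_simps)
      also have "\<dots> \<le> c + d\<^sup>2 + 2 * y * (M + 1)"
        using c' dsq y by (intro add_mono mult_left_mono) auto
      also have "\<dots> = c + Q * d\<^sup>2" by (simp add: Q_def y_def algebra_simps)
      finally show ?thesis .
    qed
    show ?thesis
    proof (intro exI[of _ "\<lambda>z. b z /\<^sub>R norm (b z)"] conjI ballI)
      have "continuous_on X b" unfolding b_def by (intro continuous_intros a cp')
      then show "continuous_on X (\<lambda>z. b z /\<^sub>R norm (b z))"
        using nb by (intro continuous_intros) force+
      fix y assume y: "y \<in> X"
      show "norm (b y /\<^sub>R norm (b y)) = 1" using nb[OF y] by simp
      show "(b y /\<^sub>R norm (b y)) \<bullet> p' y = 0" using est(3)[OF y] by simp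
      have "h (p' y) (b y /\<^sub>R norm (b y)) = h (p' y) (b y) / norm (b y)"
        using homog[OF z(2)[OF y], of "inverse (norm (b y))" "b y"] by (simp add: divide_inverse_commute)
      also have "\<dots> \<le> (c' + d\<^sup>2) / \<kappa>"
        using est[OF y] \<kappa> nonneg[OF z(2)[OF y], of "b y"] c' by (intro frac_le) auto
      finally show "h (p' y) (b y /\<^sub>R norm (b y)) \<le> c + Q * d\<^sup>2" using final by linarith
    qed
  qed
  show ?thesis
    by (rule exI[of _ Q], rule conjI[OF Q], rule exI[of _ d0], rule conjI[OF d0],
        intro allI impI, elim conjE, rule_tac p = p and v = v in main) auto
qed

text \<open>Each \<open>z\<close> in \<open>X\<close> has its own path from \<open>e\<close>, and
  the field starts as the constant \<open>v0\<close>. For \<open>n\<close> steps of length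
  \<open>L / n\<close> the losses add up to \<open>Q * L\<^sup>2 / n\<close>, which is at most
  \<epsilon> for large \<open>n\<close>.\<close>

lemma transport_along_paths:
  fixes X :: "(real^'n) set"
  assumes X: "compact X" and v0: "norm v0 = 1" "v0 \<bullet> e = 0" and eps: "0 < \<epsilon>"
    and g0: "\<And>z. z \<in> X \<Longrightarrow> \<gamma> 0 z = e"
    and gn: "\<And>t z. z \<in> X \<Longrightarrow> 0 \<le> t \<Longrightarrow> t \<le> 1 \<Longrightarrow> norm (\<gamma> t z) = 1"
    and gc: "\<And>t. 0 \<le> t \<Longrightarrow> t \<le> 1 \<Longrightarrow> continuous_on X (\<gamma> t)"
    and gl: "\<And>s t z. z \<in> X \<Longrightarrow> 0 \<le> s \<Longrightarrow> s \<le> 1 \<Longrightarrow> 0 \<le> t \<Longrightarrow> t \<le> 1 \<Longrightarrow> norm (\<gamma> s z - \<gamma> t z) \<le> L * \<bar>s - t\<bar>"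
    and L: "0 < L" and e: "norm e = 1"
  shows "\<exists>v. continuous_on X v \<and> (\<forall>z\<in>X. norm (v z) = 1 \<and> v z \<bullet> \<gamma> 1 z = 0 \<and> h (\<gamma> 1 z) (v z) \<le> h e v0 + \<epsilon>)"
proof -
  obtain Q d0 where Q: "Q > 0" and d0: "d0 > 0" and step: "\<And>(X::(real^'n) set) p p' v c d.
     compact X \<and> continuous_on X p \<and> continuous_on X p' \<and> continuous_on X v \<and>
     (\<forall>z\<in>X. norm (p z) = 1 \<and> norm (p' z) = 1 \<and> norm (v z) = 1 \<and> v z \<bullet> p z = 0 \<and>
        h (p z) (v z) \<le> c \<and> norm (p z - p' z) \<le> d) \<and> 0 \<le> c \<and> 0 < d \<and> d \<le> d0 \<Longrightarrow>
     (\<exists>v'. continuous_on X v' \<and> (\<forall>z\<in>X. norm (v' z) = 1 \<and> v' z \<bullet> p' z = 0 \<and> h (p' z) (v' z) \<le> c + Q * d\<^sup>2))"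
    using transport_step by blast
  obtain n :: nat where n: "n > 0" "L / d0 \<le> n" "Q * L\<^sup>2 / \<epsilon> \<le> n"
  proof -
    obtain m :: nat where "max (L / d0) (Q * L\<^sup>2 / \<epsilon>) \<le> m" using real_arch_simple by blast
    then show ?thesis by (intro that[of "Suc m"]) auto
  qed
  define d where "d = L / n"
  have d: "0 < d" "d \<le> d0" using n L d0 by (auto simp: d_def field_simps)
  have nd: "n * (Q * d\<^sup>2) \<le> \<epsilon>"
  proof -
    have "n * (Q * d\<^sup>2) = Q * L\<^sup>2 / n" using n by (simp add: d_def power2_eq_square)
    also have "\<dots> \<le> \<epsilon>" using n eps by (simp add: field_simps)
    finally show ?thesis .
  qed
  have c0: "0 \<le> h e v0" by (rule nonneg[OF e])
  have "i \<le> n \<Longrightarrow> \<exists>v. continuous_on X v \<and> (\<forall>z\<in>X. norm (v z) = 1 \<and> v z \<bullet> \<gamma> (i / n) z = 0 \<and>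
      h (\<gamma> (i / n) z) (v z) \<le> h e v0 + i * (Q * d\<^sup>2))" for i :: nat
  proof (induction i)
    case 0
    show ?case by (rule exI[of _ "\<lambda>_. v0"]) (use v0 g0 in auto)
  next
    case (Suc i)
    then obtain v where v: "continuous_on X v" "\<And>z. z \<in> X \<Longrightarrow> norm (v z) = 1 \<and> v z \<bullet> \<gamma> (i / n) z = 0 \<and>
      h (\<gamma> (i / n) z) (v z) \<le> h e v0 + i * (Q * d\<^sup>2)" by auto
    have t: "0 \<le> i / n" "i / n \<le> 1" "0 \<le> Suc i / n" "Suc i / n \<le> 1" using Suc.prems n by auto
    have "\<bar>i / n - Suc i / n\<bar> = 1 / n" by (simp flip: diff_divide_distrib)
    then have "norm (\<gamma> (i / n) z - \<gamma> (Suc i / n) z) \<le> d" if "z \<in> X" for z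
      using gl[OF that t] by (simp add: d_def)
    then have "\<exists>v'. continuous_on X v' \<and> (\<forall>z\<in>X. norm (v' z) = 1 \<and> v' z \<bullet> \<gamma> (Suc i / n) z = 0 \<and>
        h (\<gamma> (Suc i / n) z) (v' z) \<le> (h e v0 + i * (Q * d\<^sup>2)) + Q * d\<^sup>2)"
      using t X v c0 Q d gn by (intro step[of X "\<gamma> (i / n)" "\<gamma> (Suc i / n)" v]) (auto intro!: gc add_nonneg_nonneg)
    then show ?case by (simp add: algebra_simps)
  qed
  from this[of n] obtain v where v: "continuous_on X v" "\<And>z. z \<in> X \<Longrightarrow> norm (v z) = 1 \<and> v z \<bullet> \<gamma> (n / n) z = 0 \<and>
      h (\<gamma> (n / n) z) (v z) \<le> h e v0 + n * (Q * d\<^sup>2)" by auto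
  show ?thesis
    using v n nd by (intro exI[of _ v] conjI v ballI) (force simp del: of_nat_0_less_iff)+
qed


end

section \<open>Constancy of the seminorms on unit tangents\<close>

lemma unit_extremum_perp:
  fixes f :: "real^'n \<Rightarrow> real"
  assumes f: "continuous_on UNIV f" and card: "CARD('n) \<ge> 2"
  obtains v w where "norm v = 1" "v \<bullet> e = 0" "norm w = 1" "w \<bullet> e = 0"
    "\<And>u. norm u = 1 \<Longrightarrow> u \<bullet> e = 0 \<Longrightarrow> f v \<le> f u \<and> f u \<le> f w"
proof -
  let ?S = "sphere 0 1 \<inter> {u. u \<bullet> e = 0}"
  have "compact ?S"
    by (intro compact_Int_closed compact_sphere closed_Collect_eq continuous_intros)
  moreover have "?S \<noteq> {}"
  proof -
    obtain u where u: "u \<noteq> 0" "orthogonal e u"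
      using orthogonal_to_vector_exists[of e] card by auto
    then have "u /\<^sub>R norm u \<in> ?S" by (simp add: orthogonal_def inner_commute)
    then show ?thesis by blast
  qed
  moreover have "continuous_on ?S f" using f continuous_on_subset by blast
  ultimately obtain v w where "v \<in> ?S" "w \<in> ?S" "\<forall>u\<in>?S. f v \<le> f u" "\<forall>u\<in>?S. f u \<le> f w"
    using continuous_attains_inf[of ?S f] continuous_attains_sup[of ?S f] by blast
  then show ?thesis by (intro that[of v w]) auto
qed

text \<open>The segment from \<open>e\<close> to \<open>x\<close> comes closest to the origin at its
  midpoint, at distance \<open>norm (x + e) / 2\<close>. It can therefore be normalised to a path on
  the sphere as long as \<open>x\<close> stays away from \<open>- e\<close>.\<close>

lemma normalize_segment:
  fixes e :: "'a::real_inner"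
  assumes e: "norm e = 1" and x: "norm x = 1" "norm (x + e) \<ge> \<eta> / 2" and t: "0 \<le> t" "t \<le> 1"
  shows "norm ((1 - t) *\<^sub>R e + t *\<^sub>R x) \<ge> \<eta> / 4"
proof (cases "\<eta> \<le> 0")
  case True
  then show ?thesis by (meson divide_nonpos_pos norm_ge_zero order_trans zero_less_numeral)
next
  case False
  have 1: "(norm (x + e))\<^sup>2 = 2 + 2 * (e \<bullet> x)"
    using e x by (simp add: power2_norm_eq_inner inner_add_left inner_add_right norm_eq_1 inner_commute)
  have 2: "(norm ((1 - t) *\<^sub>R e + t *\<^sub>R x))\<^sup>2 = 1 - 2 * t * (1 - t) * (1 - e \<bullet> x)"
  proof -
    have "e \<bullet> e = 1" "x \<bullet> x = 1" using e x by (simp_all add: norm_eq_1)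
    then show ?thesis
      by (simp add: power2_norm_eq_inner inner_add_left inner_add_right inner_commute algebra_simps)
  qed
  have "\<bar>e \<bullet> x\<bar> \<le> 1" using Cauchy_Schwarz_ineq2[of e x] e x by simp
  then have "2 * t * (1 - t) * (1 - e \<bullet> x) \<le> 1 / 2 * (1 - e \<bullet> x)"
  proof (intro mult_right_mono)
    have "0 \<le> (2 * t - 1)\<^sup>2" by simp
    then show "2 * t * (1 - t) \<le> 1 / 2" by (simp add: power2_eq_square algebra_simps)
  qed auto
  then have "(norm (x + e) / 2)\<^sup>2 \<le> (norm ((1 - t) *\<^sub>R e + t *\<^sub>R x))\<^sup>2"
    using 1 2 by (simp add: power_divide)
  then have "norm (x + e) / 2 \<le> norm ((1 - t) *\<^sub>R e + t *\<^sub>R x)"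
    by (rule power2_le_imp_le) simp
  then show ?thesis using x by linarith
qed

context congruent_seminorm_field
begin

theorem constant_on_unit_tangents:
  assumes card: "CARD('n) \<ge> 2" "odd (CARD('n))"
  shows "\<exists>w. \<forall>x u. norm x = 1 \<longrightarrow> norm u = 1 \<longrightarrow> u \<bullet> x = 0 \<longrightarrow> h x u = w"
proof -
  obtain e :: "real^'n" where e: "norm e = 1" using exists_unit by blast
  have e': "norm (- e) = 1" using e by simp
  \<comment> \<open>Extremal directions at \<open>- e\<close>, the centre of the later cap; the
    congruences make their values the extremal values at every point.\<close>
  obtain v0 w0 where v0: "norm v0 = 1" "v0 \<bullet> (- e) = 0" and w0: "norm w0 = 1" "w0 \<bullet> (- e) = 0" and
    ext: "\<And>u. norm u = 1 \<Longrightarrow> u \<bullet> (- e) = 0 \<Longrightarrow> h (- e) v0 \<le> h (- e) u \<and> h (- e) u \<le> h (- e) w0"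
    using unit_extremum_perp[OF continuous_right[OF e'] card(1), of "- e"] by blast
  have all: "h (- e) v0 \<le> h x u \<and> h x u \<le> h (- e) w0" if x: "norm x = 1" and u: "norm u = 1" "u \<bullet> x = 0" for x u
  proof -
    obtain g where g: "g \<in> orth_blinfuns" "blinfun_apply g x = - e" "\<forall>u. h (- e) (blinfun_apply g u) = h x u"
      using cong[OF x e'] by blast
    have "blinfun_apply g u \<bullet> blinfun_apply g x = u \<bullet> x" by (rule orth_blinfun_inner[OF g(1)])
    then show ?thesis
      using ext[of "blinfun_apply g u"] g u by (simp add: norm_orth_blinfun)
  qed
  have "h (- e) w0 \<le> h (- e) v0"
  proof (rule ccontr)
    assume less: "\<not> ?thesis"
    \<comment> \<open>A third of the gap: transport loses one \<epsilon>, and moving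
      \<open>w0\<close> within the cap loses less than two, so the two seminorm values stay
      apart.\<close>
    define \<epsilon> where "\<epsilon> = (h (- e) w0 - h (- e) v0) / 3"
    have eps: "\<epsilon> > 0" using less by (simp add: \<epsilon>_def)
    obtain u0 where u0: "norm u0 = 1" "u0 \<bullet> e = 0" "h e u0 = h (- e) v0"
    proof -
      obtain g where g: "g \<in> orth_blinfuns" "blinfun_apply g (- e) = e" "\<forall>u. h e (blinfun_apply g u) = h (- e) u"
        using cong[OF e' e] by blast
      have "blinfun_apply g v0 \<bullet> blinfun_apply g (- e) = v0 \<bullet> (- e)" by (rule orth_blinfun_inner[OF g(1)])
      then show ?thesis
        using that[of "blinfun_apply g v0"] g v0 by (simp add: norm_orth_blinfun)
    qed
    define \<eta> where "\<eta> = min (1/2) (\<epsilon> / (\<Lambda> + 1))"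
    have eta: "0 < \<eta>" "\<eta> \<le> 1/2"
      using eps \<Lambda>_nonneg min.cobounded1[of "1/2" "\<epsilon> / (\<Lambda> + 1)"] by (simp_all add: \<eta>_def del: min.cobounded1)
    have "\<eta> * (\<Lambda> + 1) \<le> \<epsilon>"
    proof -
      have "\<eta> \<le> \<epsilon> / (\<Lambda> + 1)" by (simp add: \<eta>_def)
      then show ?thesis using \<Lambda>_nonneg by (simp add: pos_le_divide_eq)
    qed
    then have eta\<Lambda>: "\<Lambda> * \<eta> < 2 * \<epsilon>" using eta eps by (simp add: algebra_simps)
    \<comment> \<open>The fields are joined where the distance to \<open>- e\<close> lies between
      \<open>\<eta> / 2\<close> and \<eta>, so transport from \<open>e\<close> is needed only
      outside the smaller cap.\<close>
    define X where "X = sphere 0 1 \<inter> {x. norm (x + e) \<ge> \<eta> / 2}"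
    have X: "compact X" unfolding X_def
      by (intro compact_Int_closed compact_sphere closed_Collect_le continuous_intros)
    define m where "m = (\<lambda>t x. (1 - t) *\<^sub>R e + t *\<^sub>R x)"
    define \<gamma> where "\<gamma> = (\<lambda>t x. m t x /\<^sub>R norm (m t x))"
    have mb: "norm (m t x) \<ge> \<eta> / 4" if "x \<in> X" "0 \<le> t" "t \<le> 1" for t x
      unfolding m_def using that e by (intro normalize_segment) (auto simp: X_def)
    have m0: "m t x \<noteq> 0" if "x \<in> X" "0 \<le> t" "t \<le> 1" for t x
      using mb[OF that] eta by auto
    have "\<exists>v. continuous_on X v \<and> (\<forall>z\<in>X. norm (v z) = 1 \<and> v z \<bullet> \<gamma> 1 z = 0 \<and> h (\<gamma> 1 z) (v z) \<le> h e u0 + \<epsilon>)"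
    proof (rule transport_along_paths[OF X u0(1,2) eps, where L = "16 / \<eta>"])
      show "\<gamma> 0 z = e" for z using e by (simp add: \<gamma>_def m_def)
      show "norm (\<gamma> t z) = 1" if "z \<in> X" "0 \<le> t" "t \<le> 1" for t z
        using m0[OF that] by (simp add: \<gamma>_def)
      show "continuous_on X (\<gamma> t)" if t: "0 \<le> t" "t \<le> 1" for t
      proof -
        have "continuous_on X (m t)" unfolding m_def by (intro continuous_intros)
        then show ?thesis unfolding \<gamma>_def using m0[OF _ t] by (intro continuous_intros) auto
      qed
      show "norm (\<gamma> s z - \<gamma> t z) \<le> 16 / \<eta> * \<bar>s - t\<bar>" if z: "z \<in> X" and s: "0 \<le> s" "s \<le> 1" and t: "0 \<le> t" "t \<le> 1" for s t z
      proof -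
        have "m s z - m t z = (s - t) *\<^sub>R (z - e)" by (simp add: m_def algebra_simps)
        moreover have "norm (z - e) \<le> 2" using norm_triangle_ineq4[of z e] z e by (simp add: X_def)
        ultimately have 1: "norm (m s z - m t z) \<le> \<bar>s - t\<bar> * 2" by (simp add: mult_left_mono)
        have "norm (\<gamma> s z - \<gamma> t z) \<le> 2 * norm (m s z - m t z) / norm (m s z)"
          unfolding \<gamma>_def by (rule norm_normalize_diff_le[OF m0[OF z s] m0[OF z t]])
        also have "\<dots> \<le> (2 * (\<bar>s - t\<bar> * 2)) / (\<eta> / 4)"
          using 1 mb[OF z s] eta by (intro frac_le) auto
        also have "\<dots> = 16 / \<eta> * \<bar>s - t\<bar>" by simp
        finally show ?thesis .
      qed
    qed (use eta e in auto)
    then obtain v where v: "continuous_on X v" "\<And>z. z \<in> X \<Longrightarrow> norm (v z) = 1 \<and> v z \<bullet> \<gamma> 1 z = 0 \<and> h (\<gamma> 1 z) (v z) \<le> h e u0 + \<epsilon>"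
      by blast
    have \<gamma>1: "\<gamma> 1 z = z" if "z \<in> X" for z using that by (simp add: \<gamma>_def m_def X_def)
    \<comment> \<open>\<open>Z\<close> is the tangential part of the constant vector
      \<open>w0\<close>; the weight \<open>l\<close> rises from \<open>0\<close> to \<open>1\<close>
      while the distance to \<open>- e\<close> grows from \<open>\<eta> / 2\<close> to
      \<eta>.\<close>
    define Z where "Z = (\<lambda>x. w0 - (w0 \<bullet> x) *\<^sub>R x)"
    define l where "l = (\<lambda>x. min 1 (2 * norm (x + e) / \<eta> - 1))"
    define V where "V = (\<lambda>x. if \<eta> / 2 \<le> norm (x + e) then l x *\<^sub>R v x - (1 - l x) *\<^sub>R Z x else - Z x)"
    have Z: "Z x \<noteq> 0" "norm (Z x) \<le> 1" "h x (Z x) > h (- e) v0 + \<epsilon>" if x: "norm x = 1" "norm (x + e) \<le> \<eta>" for x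
    proof -
      have "w0 \<bullet> x = w0 \<bullet> (x + e)" using w0 by (simp add: inner_add_right)
      also have "\<bar>\<dots>\<bar> \<le> norm w0 * norm (x + e)" by (rule Cauchy_Schwarz_ineq2)
      finally have 1: "\<bar>w0 \<bullet> x\<bar> \<le> 1/2" using w0 x eta by simp
      show "Z x \<noteq> 0"
      proof
        assume "Z x = 0"
        then have "norm w0 = \<bar>w0 \<bullet> x\<bar>" using x by (metis Z_def eq_iff_diff_eq_0 norm_scaleR mult.right_neutral)
        then show False using 1 w0 by simp
      qed
      have "x \<bullet> x = 1" "w0 \<bullet> w0 = 1" using x w0 by (simp_all add: norm_eq_1)
      then have "(norm (Z x))\<^sup>2 = 1 - (w0 \<bullet> x)\<^sup>2"
        unfolding Z_def power2_norm_eq_inner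
        by (simp add: inner_diff_left inner_diff_right inner_commute power2_eq_square)
      then have "(norm (Z x))\<^sup>2 \<le> 1\<^sup>2" by simp
      then show "norm (Z x) \<le> 1" by (rule power2_le_imp_le) simp
      have "h x (Z x) = h x w0" using tangential[OF x(1), of w0 "- (w0 \<bullet> x)"] by (simp add: Z_def)
      moreover have "\<bar>h x w0 - h (- e) w0\<bar> \<le> \<Lambda> * norm (x - - e) * norm w0" by (rule lipschitz[OF x(1) e'])
      moreover have "\<Lambda> * norm (x - - e) * norm w0 \<le> \<Lambda> * \<eta>" using w0 x \<Lambda>_nonneg by (simp add: mult_left_mono)
      ultimately have "h x (Z x) \<ge> h (- e) w0 - \<Lambda> * \<eta>" by linarith
      moreover have "3 * \<epsilon> = h (- e) w0 - h (- e) v0" unfolding \<epsilon>_def by simp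
      ultimately show "h x (Z x) > h (- e) v0 + \<epsilon>" using eta\<Lambda> by linarith
    qed
    have Vnz: "V x \<noteq> 0" if x: "norm x = 1" for x
    proof (cases "norm (x + e) \<le> \<eta>")
      case False
      then have "l x = 1" using eta by (simp add: l_def min_def field_simps)
      moreover have "x \<in> X" using False x eta by (simp add: X_def)
      ultimately show ?thesis using v(2)[of x] False eta by (auto simp: V_def)
    next
      case True
      show ?thesis
      proof (cases "\<eta> / 2 \<le> norm (x + e)")
        case False
        then show ?thesis using Z[OF x True] by (simp add: V_def)
      next
        case inX: True
        then have xX: "x \<in> X" using x by (simp add: X_def)
        have vx: "norm (v x) = 1" "h x (v x) \<le> h (- e) v0 + \<epsilon>" using v(2)[OF xX] u0 by (auto simp: \<gamma>1[OF xX])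
        have l: "0 \<le> l x" "l x \<le> 1" using inX eta by (auto simp: l_def field_simps)
        show ?thesis
        proof
          \<comment> \<open>At a zero the weighted vectors \<open>v x\<close> and \<open>Z x\<close>
            coincide. As \<open>Z x\<close> is no longer than the unit vector \<open>v x\<close>,
            comparing norms gives \<open>l x \<le> 1 - l x\<close>; but \<open>v x\<close> has the
            strictly smaller seminorm, so the seminorms of the two sides differ.\<close>
          assume "V x = 0"
          then have eq: "l x *\<^sub>R v x = (1 - l x) *\<^sub>R Z x" using inX by (simp add: V_def)
          then have n: "l x = (1 - l x) * norm (Z x)" using vx(1) l by (metis abs_of_nonneg diff_ge_0_iff_ge mult.right_neutral norm_scaleR)
          have "h x (l x *\<^sub>R v x) = h x ((1 - l x) *\<^sub>R Z x)" by (simp add: eq)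
          then have hh: "l x * h x (v x) = (1 - l x) * h x (Z x)" using l by (simp add: homog[OF x])
          have "1 - l x > 0"
          proof (rule ccontr)
            assume "\<not> 0 < 1 - l x" then have "l x = 1" using l by simp
            then show False using n by simp
          qed
          have "l x * h x (v x) \<le> (1 - l x) * h x (v x)"
          proof (rule mult_right_mono[OF _ nonneg[OF x]])
            show "l x \<le> 1 - l x"
              using n mult_left_le[OF Z(2)[OF x True], of "1 - l x"] \<open>1 - l x > 0\<close> by linarith
          qed
          also have "\<dots> < (1 - l x) * h x (Z x)"
            using vx(2) Z(3)[OF x True] \<open>1 - l x > 0\<close> by (intro mult_strict_left_mono) auto
          finally show False using hh by simp
        qed
      qed
    qed
    have "continuous_on (sphere 0 1) V"
    proof -
      let ?A = "sphere 0 1 \<inter> {x. norm (x + e) \<ge> \<eta> / 2}" and ?B = "sphere 0 1 \<inter> {x. norm (x + e) \<le> \<eta> / 2}"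
      have "continuous_on (?A \<union> ?B) V"
        unfolding V_def
      proof (rule continuous_on_cases)
        show "closed ?A" "closed ?B"
          by (intro closed_Int closed_sphere closed_Collect_le continuous_intros)+
        show "continuous_on ?A (\<lambda>x. l x *\<^sub>R v x - (1 - l x) *\<^sub>R Z x)"
          unfolding l_def Z_def using eta v(1) X_def by (intro continuous_intros) auto
        show "continuous_on ?B (\<lambda>x. - Z x)"
          unfolding Z_def by (intro continuous_intros)
        show "\<forall>x. x \<in> ?A \<and> \<not> \<eta> / 2 \<le> norm (x + e) \<or> x \<in> ?B \<and> \<eta> / 2 \<le> norm (x + e) \<longrightarrow>
          l x *\<^sub>R v x - (1 - l x) *\<^sub>R Z x = - Z x"
        proof (intro allI impI)
          fix x assume "x \<in> ?A \<and> \<not> \<eta> / 2 \<le> norm (x + e) \<or> x \<in> ?B \<and> \<eta> / 2 \<le> norm (x + e)"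
          then have nn: "norm (x + e) = \<eta> / 2" by auto
          have n1: "2 * norm (x + e) / \<eta> = 1" unfolding nn using eta by simp
          have "l x = 0" unfolding l_def n1 by simp
          then show "l x *\<^sub>R v x - (1 - l x) *\<^sub>R Z x = - Z x" by simp
        qed
      qed
      moreover have "?A \<union> ?B = sphere 0 1" by auto
      ultimately show ?thesis by simp
    qed
    moreover have "x \<bullet> V x = 0" if x: "norm x = 1" for x
    proof -
      have "x \<bullet> Z x = 0" using x by (simp add: Z_def inner_diff_right norm_eq_1 inner_commute)
      moreover have "x \<bullet> v x = 0" if "\<eta> / 2 \<le> norm (x + e)"
      proof -
        have "x \<in> X" using x that by (simp add: X_def)
        then show ?thesis using v(2)[of x] by (simp add: \<gamma>1 inner_commute)
      qed
      ultimately show ?thesis by (simp add: V_def inner_diff_right)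
    qed
    ultimately obtain x where "norm x = 1" "V x = 0"
      using hairy_ball[OF card(2), of V] by blast
    then show False using Vnz by blast
  qed
  then show ?thesis using all by (intro exI[of _ "h (- e) v0"]) (meson order_trans order_antisym)
qed

end

section \<open>Tangent chords of planar bodies\<close>

text \<open>As the two tangents sum to \<open>2 * r\<close>, the addition formula gives \<open>sin
  (\<alpha> + \<beta>) = 2 * r * (cos \<alpha> * cos \<beta>)\<close>. Comparison with the symmetric
  pair, after division by \<open>r\<close>, fixes the product of cosines and forces
  \<open>cos (\<alpha> - \<beta>) = 1\<close>.\<close>

lemma arctan_add_const_sum:
  assumes "arctan x + arctan (2 * r - x) = 2 * arctan r" and "r \<noteq> 0"
  shows "x = r"
proof -
  define \<alpha> \<beta> \<phi> where "\<alpha> = arctan x" and "\<beta> = arctan (2 * r - x)" and "\<phi> = arctan r"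
  have s: "sin (arctan t) = t * cos (arctan t)" for t :: real
    using tan_arctan[of t] cos_arctan_not_zero[of t] by (simp add: tan_def field_simps)
  have ab: "\<alpha> + \<beta> = 2 * \<phi>" using assms(1) by (simp add: \<alpha>_def \<beta>_def \<phi>_def)
  have "sin (\<alpha> + \<beta>) = 2 * r * (cos \<alpha> * cos \<beta>)"
    unfolding sin_add unfolding \<alpha>_def \<beta>_def s by (simp add: algebra_simps)
  moreover have "sin (2 * \<phi>) = 2 * r * (cos \<phi> * cos \<phi>)"
    unfolding sin_double unfolding \<phi>_def s by simp
  ultimately have "cos \<alpha> * cos \<beta> = cos \<phi> * cos \<phi>" using ab assms(2) by simp
  moreover have "cos (\<alpha> - \<beta>) + cos (\<alpha> + \<beta>) = 2 * (cos \<alpha> * cos \<beta>)"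
    unfolding cos_add cos_diff by simp
  moreover have "1 + cos (2 * \<phi>) = 2 * (cos \<phi> * cos \<phi>)"
    unfolding cos_double_cos power2_eq_square by simp
  ultimately have "cos (\<alpha> - \<beta>) = 1" unfolding ab by linarith
  then have "cos \<bar>\<alpha> - \<beta>\<bar> = cos 0" by simp
  moreover have "\<bar>\<alpha> - \<beta>\<bar> \<le> pi"
    using arctan_bounded[of x] arctan_bounded[of "2 * r - x"] by (auto simp: \<alpha>_def \<beta>_def abs_if)
  ultimately have "\<bar>\<alpha> - \<beta>\<bar> = 0" using cos_inj_pi[of "\<bar>\<alpha> - \<beta>\<bar>" 0] by simp
  then have "x = 2 * r - x" by (simp add: \<alpha>_def \<beta>_def arctan_eq_iff)
  then show ?thesis by simp
qed

text \<open>For the tangents of a planar body, \<open>T\<close> sends a point of the unit circle to the second end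
  of the chord tangent to the body. The hypotheses make \<open>T \<circ> T\<close> a rotation on every level set of
  \<open>f\<close>; since it preserves the cyclic order, all these rotations have the same angle.\<close>

lemma tangent_chord_map_constant:
  fixes f :: "real \<Rightarrow> real"
  assumes cont: "continuous_on UNIV f" and per: "\<And>s. f (s + 2 * pi) = f s"
    and eq: "\<And>s. f (s + pi - 2 * arctan (f s)) = 2 * r - f s" and r: "r \<noteq> 0"
  shows "f s = r"
proof -
  define T where "T = (\<lambda>s. s + pi - 2 * arctan (f s))"
  \<comment> \<open>\<open>T\<close> is written as a lift to the real line. The displacement
    \<theta> of its square depends on \<open>s\<close> only through \<open>f s\<close>, which the
    square preserves.\<close>
  define \<theta> where "\<theta> = (\<lambda>s. 2 * pi - 2 * (arctan (f s) + arctan (2 * r - f s)))"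
  have fT: "f (T s) = 2 * r - f s" for s using eq by (simp add: T_def)
  have TT: "T (T s) = s + \<theta> s" for s
  proof -
    have T: "T t = t + pi - 2 * arctan (f t)" for t by (simp add: T_def)
    show ?thesis using T[of "T s"] T[of s] fT[of s] by (simp add: \<theta>_def)
  qed
  have perN: "f (s + 2 * pi * real m) = f s" for s m
  proof (induction m)
    case (Suc m)
    have "f (s + 2 * pi * real (Suc m)) = f ((s + 2 * pi * real m) + 2 * pi)" by (simp add: algebra_simps)
    then show ?case using Suc per by simp
  qed simp
  have contT: "continuous_on UNIV T" unfolding T_def by (intro continuous_intros cont)
  \<comment> \<open>The value \<open>T a\<close> determines \<open>f a\<close> by \<open>fT\<close>,
    and then \<open>a\<close> itself.\<close>
  have inj: "inj T"
  proof (rule injI)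
    fix a b assume "T a = T b"
    then have "f a = f b" using fT[of a] fT[of b] by simp
    then show "a = b" using \<open>T a = T b\<close> by (simp add: T_def)
  qed
  \<comment> \<open>A continuous injection is monotone, and translation by full periods shows that
    it increases.\<close>
  have mono: "T a < T b" if "a < b" for a b
  proof -
    obtain m :: nat where "(b - a) / (2 * pi) < real m" using reals_Archimedean2 by blast
    then have m: "b < a + 2 * pi * m" by (simp add: field_simps)
    have "T (a + 2 * pi * m) = T a + 2 * pi * m" by (simp add: T_def perN)
    then show ?thesis
      using continuous_inj_imp_mono[OF that m continuous_on_subset[OF contT] inj_on_subset[OF inj]] that m by auto
  qed
  have iter: "((\<lambda>s. T (T s)) ^^ n) s = s + n * \<theta> s \<and> f (((\<lambda>s. T (T s)) ^^ n) s) = f s" for n s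
  proof (induction n)
    case (Suc n)
    let ?s = "((\<lambda>s. T (T s)) ^^ n) s"
    have "?s = s + n * \<theta> s" and fs: "f ?s = f s" using Suc by blast+
    moreover have "\<theta> ?s = \<theta> s" by (simp only: \<theta>_def fs)
    ultimately have "T (T ?s) = s + Suc n * \<theta> s" unfolding TT by (simp add: algebra_simps)
    moreover have "f (T (T ?s)) = f s" by (simp add: fT fs)
    ultimately show ?case by simp
  qed simp
  have iter_mono: "((\<lambda>s. T (T s)) ^^ n) a < ((\<lambda>s. T (T s)) ^^ n) b" if "a < b" for n a b
    by (induction n) (auto simp: that mono)
  \<comment> \<open>Orbits that start with \<open>a < b < a + 2 * pi * m\<close> stay interlaced, so
    \<open>n * \<theta> a\<close> and \<open>n * \<theta> b\<close> differ by a bounded amount for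
    all \<open>n\<close>.\<close>
  have "\<theta> a = \<theta> b" if "a < b" for a b
  proof (rule ccontr)
    assume ne: "\<theta> a \<noteq> \<theta> b"
    obtain m :: nat where "(b - a) / (2 * pi) < real m" using reals_Archimedean2 by blast
    then have m: "b < a + 2 * pi * m" by (simp add: field_simps)
    have pm: "\<theta> (a + 2 * pi * m) = \<theta> a" by (simp add: \<theta>_def perN)
    obtain n :: nat where n: "(b - a + 2 * pi * m) / \<bar>\<theta> a - \<theta> b\<bar> < real n" using reals_Archimedean2 by blast
    then have n: "b - a + 2 * pi * m < n * \<bar>\<theta> a - \<theta> b\<bar>" using ne by (simp add: field_simps)
    have 1: "a + n * \<theta> a < b + n * \<theta> b" using iter_mono[OF that, of n] iter by simp
    have 2: "b + n * \<theta> b < a + 2 * pi * m + n * \<theta> a" using iter_mono[OF m, of n] iter pm by simp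
    have "n * \<bar>\<theta> a - \<theta> b\<bar> = \<bar>n * \<theta> a - n * \<theta> b\<bar>" by (simp add: abs_mult flip: right_diff_distrib)
    moreover have "\<bar>n * \<theta> a - n * \<theta> b\<bar> < b - a + 2 * pi * m" using 1 2 that by (simp add: abs_less_iff)
    ultimately show False using n by simp
  qed
  then have const: "\<theta> a = \<theta> b" for a b by (metis linorder_neqE_linordered_idom)
  \<comment> \<open>\<open>f 0\<close> and \<open>f (T 0)\<close> lie symmetrically about
    \<open>r\<close>, so \<open>f\<close> takes the value \<open>r\<close> in between; such a point
    identifies the constant \<theta>.\<close>
  have "\<exists>s0. f s0 = r"
  proof -
    have T0: "0 \<le> T 0" using arctan_bounded[of "f 0"] by (simp add: T_def)
    have c: "continuous_on {0..T 0} f" using cont continuous_on_subset by blast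
    show ?thesis
    proof (cases "f 0 \<le> r")
      case True
      then show ?thesis using IVT'[of f 0 r "T 0"] fT[of 0] T0 c by auto
    next
      case False
      then show ?thesis using IVT2'[of f "T 0" r 0] fT[of 0] T0 c by auto
    qed
  qed
  then obtain s0 where "f s0 = r" by blast
  then have "\<theta> s = 2 * pi - 4 * arctan r" using const[of s s0] by (simp add: \<theta>_def)
  then have "arctan (f s) + arctan (2 * r - f s) = 2 * arctan r" by (simp add: \<theta>_def)
  then show ?thesis using r by (rule arctan_add_const_sum)
qed

section \<open>Support functions\<close>

definition support_fun :: "'a::real_inner set \<Rightarrow> 'a \<Rightarrow> real" where
  "support_fun S u = (SUP y\<in>S. u \<bullet> y)"

lemma support_fun_upper:
  assumes "compact S" "y \<in> S"
  shows "u \<bullet> y \<le> support_fun S u"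
  unfolding support_fun_def
proof (rule cSUP_upper[OF assms(2)])
  have "compact ((\<lambda>y. u \<bullet> y) ` S)" by (intro compact_continuous_image continuous_intros assms)
  then show "bdd_above ((\<lambda>y. u \<bullet> y) ` S)" by (intro bounded_imp_bdd_above compact_imp_bounded)
qed

lemma support_fun_least:
  assumes "S \<noteq> {}" "\<And>y. y \<in> S \<Longrightarrow> u \<bullet> y \<le> t"
  shows "support_fun S u \<le> t"
  unfolding support_fun_def using assms by (rule cSUP_least)

lemma support_fun_attained:
  assumes "compact S" "S \<noteq> {}"
  obtains y where "y \<in> S" "u \<bullet> y = support_fun S u"
proof -
  have "continuous_on S (\<lambda>y. u \<bullet> y)" by (intro continuous_intros)
  from continuous_attains_sup[OF assms this] obtain y where y: "y \<in> S" "\<And>z. z \<in> S \<Longrightarrow> u \<bullet> z \<le> u \<bullet> y" by blast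
  have "u \<bullet> y = support_fun S u"
    using support_fun_upper[OF assms(1) y(1)] support_fun_least[OF assms(2) y(2)] by (intro antisym)
  with y(1) that show ?thesis by blast
qed

lemma support_fun_eqI:
  assumes "compact S" "y \<in> S" "u \<bullet> y = t" "\<And>z. z \<in> S \<Longrightarrow> u \<bullet> z \<le> t"
  shows "support_fun S u = t"
  using support_fun_upper[OF assms(1,2), of u] support_fun_least[of S u t] assms by (intro antisym) auto

lemma support_fun_add_le:
  assumes "compact S" "S \<noteq> {}"
  shows "support_fun S (u + v) \<le> support_fun S u + support_fun S v"
  using support_fun_upper[OF assms(1)] by (intro support_fun_least assms) (simp add: inner_add_left add_mono)

lemma support_fun_scaleR:
  assumes "compact S" "S \<noteq> {}" "c \<ge> 0"
  shows "support_fun S (c *\<^sub>R u) = c * support_fun S u"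
proof -
  obtain y where "y \<in> S" "u \<bullet> y = support_fun S u" by (rule support_fun_attained[OF assms(1,2)])
  then show ?thesis
    using support_fun_upper[OF assms(1)] assms(3) by (intro support_fun_eqI[OF assms(1)]) (auto intro: mult_left_mono)
qed

lemma support_fun_le_bound:
  assumes "compact S" "S \<noteq> {}" "\<And>y. y \<in> S \<Longrightarrow> norm y \<le> M"
  shows "support_fun S u \<le> M * norm u"
proof (rule support_fun_least[OF assms(2)])
  fix y assume "y \<in> S"
  have "u \<bullet> y \<le> norm u * norm y" by (rule norm_cauchy_schwarz)
  also have "\<dots> \<le> norm u * M" using assms(3)[OF \<open>y \<in> S\<close>] by (intro mult_left_mono) auto
  finally show "u \<bullet> y \<le> M * norm u" by (simp add: mult.commute)
qed

text \<open>Testing a point of \<open>K\<close> in its own direction bounds its norm. Conversely, a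
  hyperplane separating a point of the ball from \<open>K\<close> would give \<open>K\<close> a
  support value below \<rho>.\<close>

lemma eq_cball_if_support_fun_constant:
  fixes K :: "'a::euclidean_space set"
  assumes K: "compact K" "convex K" "K \<noteq> {}" and c: "\<And>u. norm u = 1 \<Longrightarrow> support_fun K u = \<rho>" and \<rho>: "\<rho> \<ge> 0"
  shows "K = cball 0 \<rho>"
proof
  show "K \<subseteq> cball 0 \<rho>"
  proof
    fix y assume y: "y \<in> K"
    show "y \<in> cball 0 \<rho>"
    proof (cases "y = 0")
      case False
      have "(y /\<^sub>R norm y) \<bullet> y \<le> \<rho>" using support_fun_upper[OF K(1) y, of "y /\<^sub>R norm y"] c[of "y /\<^sub>R norm y"] False by simp
      moreover have "(y /\<^sub>R norm y) \<bullet> y = norm y" using False by (simp add: dot_square_norm power2_eq_square)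
      ultimately show ?thesis by simp
    qed (use \<rho> in auto)
  qed
next
  show "cball 0 \<rho> \<subseteq> K"
  proof (rule ccontr)
    assume "\<not> ?thesis"
    then obtain p where "p \<in> cball 0 \<rho>" "p \<notin> K" by blast
    then have p: "norm p \<le> \<rho>" "p \<notin> K" by auto
    obtain a b where ab: "a \<bullet> p < b" "\<And>x. x \<in> K \<Longrightarrow> b < a \<bullet> x"
      using separating_hyperplane_closed_point[OF K(2) compact_imp_closed[OF K(1)] p(2)] by blast
    have a: "a \<noteq> 0" using ab K(3) by force
    let ?u = "- (a /\<^sub>R norm a)"
    obtain y where y: "y \<in> K" "?u \<bullet> y = support_fun K ?u" by (rule support_fun_attained[OF K(1,3)])
    then have "?u \<bullet> y = \<rho>" using c[of ?u] a by simp
    then have "a \<bullet> y = - norm a * \<rho>" using a by (simp add: field_simps)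
    also have "\<dots> \<le> - norm a * norm p" using p a by simp
    also have "\<dots> \<le> a \<bullet> p" using Cauchy_Schwarz_ineq2[of a p] by (simp add: abs_le_iff)
    finally show False using ab y by force
  qed
qed

section \<open>Sections of cones\<close>

text \<open>Central projection from a unit vector \<open>x\<close>: on the line from
  \<open>x\<close> through \<open>y\<close> the component along \<open>x\<close> falls linearly from
  \<open>1\<close> and vanishes at parameter \<open>1 / (1 - x \<bullet> y)\<close>.\<close>

definition cone_point :: "'a::real_inner \<Rightarrow> 'a \<Rightarrow> 'a" where
  "cone_point x y = x + (y - x) /\<^sub>R (1 - x \<bullet> y)"

lemma inner_cone_point:
  assumes "norm x = 1" "x \<bullet> y \<noteq> 1"
  shows "x \<bullet> cone_point x y = 0"
  using assms by (simp add: cone_point_def inner_add_right inner_diff_right norm_eq_1 field_simps)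

lemma inner_cone_point_perp:
  assumes "u \<bullet> x = 0"
  shows "u \<bullet> cone_point x y = (u \<bullet> y) / (1 - x \<bullet> y)"
  using assms by (simp add: cone_point_def inner_add_right inner_diff_right divide_inverse_commute)

locale body_in_unit_ball =
  fixes K :: "'a::euclidean_space set"
  assumes compact: "compact K" and convex: "convex K" and nonempty: "K \<noteq> {}" and in_ball: "K \<subseteq> ball 0 1"
begin

definition cone_section :: "'a \<Rightarrow> 'a set" where
  "cone_section x = cone_point x ` K"

lemma less_one: "norm x = 1 \<Longrightarrow> y \<in> K \<Longrightarrow> x \<bullet> y < 1"
proof -
  assume "norm x = 1" "y \<in> K"
  then show ?thesis using norm_cauchy_schwarz[of x y] in_ball by force
qed

lemma compact_section: "norm x = 1 \<Longrightarrow> compact (cone_section x)"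
  unfolding cone_section_def cone_point_def
proof (intro compact_continuous_image compact continuous_intros ballI)
  fix y assume "norm x = 1" "y \<in> K"
  then show "1 - x \<bullet> y \<noteq> 0" using less_one[of x y] by simp
qed

lemma section_nonempty: "cone_section x \<noteq> {}"
  using nonempty by (simp add: cone_section_def)

lemma section_perp: "norm x = 1 \<Longrightarrow> z \<in> cone_section x \<Longrightarrow> x \<bullet> z = 0"
  using inner_cone_point less_one unfolding cone_section_def by (metis imageE less_irrefl)

text \<open>A compact subset of the open ball keeps a gap \<delta> to the sphere, so all
  denominators \<open>1 - x \<bullet> y\<close> are at least \<delta>. \<open>B\<close> contains the
  terms of both estimates.\<close>

lemma section_lipschitz:
  obtains B where "B \<ge> 0" "\<And>x y :: 'a. norm x = 1 \<Longrightarrow> y \<in> K \<Longrightarrow> norm (cone_point x y) \<le> B"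
    "\<And>x x' y :: 'a. norm x = 1 \<Longrightarrow> norm x' = 1 \<Longrightarrow> y \<in> K \<Longrightarrow> norm (cone_point x y - cone_point x' y) \<le> B * norm (x - x')"
proof -
  have "continuous_on K norm" by (intro continuous_intros)
  from continuous_attains_sup[OF compact nonempty this]
  obtain y0 where y0: "y0 \<in> K" "\<And>y. y \<in> K \<Longrightarrow> norm y \<le> norm y0" by blast
  define \<delta> where "\<delta> = 1 - norm y0"
  have \<delta>: "\<delta> > 0" "\<delta> \<le> 1" using y0 in_ball by (auto simp: \<delta>_def)
  have low: "\<delta> \<le> 1 - x \<bullet> y" if "norm x = 1" "y \<in> K" for x y :: 'a
    using norm_cauchy_schwarz[of x y] y0(2)[OF that(2)] that by (simp add: \<delta>_def)
  have ny: "norm y \<le> 1" if "y \<in> K" for y using that in_ball by auto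
  have yx: "norm (y - x) \<le> 2" if "norm x = 1" "y \<in> K" for x y :: 'a
    using norm_triangle_ineq4[of y x] ny[OF that(2)] that by simp
  define B where "B = 1 + 1 / \<delta> + 2 / \<delta> + 2 / (\<delta> * \<delta>)"
  show ?thesis
  proof (rule that[of B])
    show "B \<ge> 0" using \<delta> by (simp add: B_def)
    fix x y :: 'a assume x: "norm x = 1" and y: "y \<in> K"
    have "norm ((y - x) /\<^sub>R (1 - x \<bullet> y)) = norm (y - x) / (1 - x \<bullet> y)"
      using low[OF x y] \<delta> by (simp add: divide_inverse_commute)
    also have "\<dots> \<le> 2 / \<delta>" using low[OF x y] yx[OF x y] \<delta> by (intro frac_le) auto
    finally have "norm (cone_point x y) \<le> 1 + 2 / \<delta>"
      using norm_triangle_ineq[of x "(y - x) /\<^sub>R (1 - x \<bullet> y)"] x by (simp add: cone_point_def)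
    also have "\<dots> \<le> B"
    proof -
      have "0 \<le> 1 / \<delta>" "0 \<le> 2 / (\<delta> * \<delta>)" using \<delta> by auto
      then show ?thesis unfolding B_def by linarith
    qed
    finally show "norm (cone_point x y) \<le> B" .
  next
    fix x x' y :: 'a assume x: "norm x = 1" and x': "norm x' = 1" and y: "y \<in> K"
    let ?a = "1 - x \<bullet> y" and ?b = "1 - x' \<bullet> y"
    have ab: "\<delta> \<le> ?a" "\<delta> \<le> ?b" using low x x' y by auto
    then have ab0: "?a > 0" "?b > 0" using \<delta> by linarith+
    have e: "cone_point x y - cone_point x' y =
        (x - x') - (x - x') /\<^sub>R ?a + ((x - x') \<bullet> y / (?a * ?b)) *\<^sub>R (y - x')"
    proof -
      have "(x - x') \<bullet> y / (?a * ?b) = inverse ?a - inverse ?b"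
        using ab0 by (simp add: inner_diff_left field_simps)
      moreover have "x + s *\<^sub>R (y - x) - (x' + t *\<^sub>R (y - x')) = (x - x') - s *\<^sub>R (x - x') + (s - t) *\<^sub>R (y - x')" for s t
        by (simp add: algebra_simps)
      ultimately show ?thesis unfolding cone_point_def by simp
    qed
    have 1: "norm ((x - x') /\<^sub>R ?a) \<le> norm (x - x') / \<delta>"
      using ab ab0 \<delta> by (simp add: divide_inverse_commute frac_le le_imp_inverse_le mult_right_mono)
    have "norm (((x - x') \<bullet> y / (?a * ?b)) *\<^sub>R (y - x')) = \<bar>(x - x') \<bullet> y\<bar> * norm (y - x') / (?a * ?b)"
      using ab0 by (simp add: abs_mult)
    also have "\<dots> \<le> (norm (x - x') * 2) / (\<delta> * \<delta>)"
    proof (intro frac_le mult_mono)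
      show "\<bar>(x - x') \<bullet> y\<bar> \<le> norm (x - x')"
        using Cauchy_Schwarz_ineq2[of "x - x'" y] mult_left_le[OF ny[OF y] norm_ge_zero[of "x - x'"]] by linarith
    qed (use ab ab0 \<delta> yx[OF x' y] in auto)
    finally have 2: "norm (((x - x') \<bullet> y / (?a * ?b)) *\<^sub>R (y - x')) \<le> norm (x - x') * 2 / (\<delta> * \<delta>)" .
    have "norm (cone_point x y - cone_point x' y) \<le> norm (x - x') + norm (x - x') / \<delta> + norm (x - x') * 2 / (\<delta> * \<delta>)"
      unfolding e using norm_triangle_ineq4[of "x - x'" "(x - x') /\<^sub>R ?a"] 1 2
      by (intro norm_triangle_le add_mono) auto
    also have "\<dots> = (1 + 1 / \<delta> + 2 / (\<delta> * \<delta>)) * norm (x - x')" by (simp add: algebra_simps)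
    also have "\<dots> \<le> B * norm (x - x')" 
    proof (rule mult_right_mono)
      have "0 \<le> 2 / \<delta>" using \<delta> by auto
      then show "1 + 1 / \<delta> + 2 / (\<delta> * \<delta>) \<le> B" unfolding B_def by linarith
    qed simp
    finally show "norm (cone_point x y - cone_point x' y) \<le> B * norm (x - x')" .
  qed
qed

end

section \<open>Widths of sections and their tangent chords\<close>

context body_in_unit_ball
begin

definition section_width :: "'a \<Rightarrow> 'a \<Rightarrow> real" where
  "section_width x u = support_fun (cone_section x) u + support_fun (cone_section x) (- u)"

lemma support_tangential:
  assumes "norm x = 1"
  shows "support_fun (cone_section x) (u + s *\<^sub>R x) = support_fun (cone_section x) u"
  unfolding support_fun_def
  by (intro SUP_cong refl) (simp add: inner_add_left section_perp[OF assms])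

lemma support_lipschitz:
  assumes B: "\<forall>x x'. \<forall>y\<in>K. norm x = 1 \<longrightarrow> norm x' = 1 \<longrightarrow> norm (cone_point x y - cone_point x' y) \<le> B * norm (x - x')"
    and x: "norm x = 1" "norm x' = 1"
  shows "support_fun (cone_section x) u \<le> support_fun (cone_section x') u + B * norm (x - x') * norm u"
proof (rule support_fun_least[OF section_nonempty])
  fix z assume "z \<in> cone_section x"
  then obtain y where y: "y \<in> K" "z = cone_point x y" by (auto simp: cone_section_def)
  have "u \<bullet> z = u \<bullet> cone_point x' y + u \<bullet> (cone_point x y - cone_point x' y)" by (simp add: y inner_diff_right)
  moreover have "u \<bullet> cone_point x' y \<le> support_fun (cone_section x') u"
    using y by (intro support_fun_upper[OF compact_section[OF x(2)]]) (simp add: cone_section_def)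
  moreover have "u \<bullet> (cone_point x y - cone_point x' y) \<le> norm u * norm (cone_point x y - cone_point x' y)"
    by (rule norm_cauchy_schwarz)
  moreover have "norm u * norm (cone_point x y - cone_point x' y) \<le> norm u * (B * norm (x - x'))"
    using B x y(1) by (intro mult_left_mono) auto
  ultimately show "u \<bullet> z \<le> support_fun (cone_section x') u + B * norm (x - x') * norm u"
    by (simp add: mult_ac)
qed

lemma continuous_support_along:
  fixes p q :: "real \<Rightarrow> 'a"
  assumes p: "continuous_on UNIV p" "\<And>s. norm (p s) = 1" and q: "continuous_on UNIV q"
  shows "continuous_on UNIV (\<lambda>s. support_fun (cone_section (p s)) (q s))"
proof -
  obtain B where B: "B \<ge> 0" "\<And>x y :: 'a. norm x = 1 \<Longrightarrow> y \<in> K \<Longrightarrow> norm (cone_point x y) \<le> B"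
    "\<And>x x' y :: 'a. norm x = 1 \<Longrightarrow> norm x' = 1 \<Longrightarrow> y \<in> K \<Longrightarrow> norm (cone_point x y - cone_point x' y) \<le> B * norm (x - x')"
    using section_lipschitz by blast
  have B': "\<forall>x x'. \<forall>y\<in>K. norm x = 1 \<longrightarrow> norm x' = 1 \<longrightarrow> norm (cone_point x y - cone_point x' y) \<le> B * norm (x - x')"
    using B(3) by blast
  let ?A = "\<lambda>x. support_fun (cone_section x)"
  have r: "?A x u \<le> ?A x v + B * norm (u - v)" if "norm x = 1" for x u v
  proof -
    have "?A x u \<le> ?A x v + ?A x (u - v)"
      using support_fun_add_le[OF compact_section[OF that] section_nonempty, of v "u - v"] by simp
    moreover have "?A x (u - v) \<le> B * norm (u - v)"
      using B(2)[OF that] by (intro support_fun_le_bound[OF compact_section[OF that] section_nonempty]) (auto simp: cone_section_def)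
    ultimately show ?thesis by linarith
  qed
  have one: "?A (p t) (q t) \<le> ?A (p s) (q s) + (B * norm (p t - p s) * norm (q s) + B * norm (q t - q s))" for s t
    using r[OF p(2), of t "q t" "q s"] support_lipschitz[OF B' p(2)[of t] p(2)[of s], of "q s"] by linarith
  have two: "?A (p s) (q s) \<le> ?A (p t) (q t) + (B * norm (p t - p s) * norm (q s) + B * norm (q t - q s))" for s t
    using r[OF p(2), of t "q s" "q t"] support_lipschitz[OF B' p(2)[of s] p(2)[of t], of "q s"]
    by (simp add: norm_minus_commute)
  show ?thesis
    unfolding continuous_on_def
  proof
    fix s :: real
    have lp: "(p \<longlongrightarrow> p s) (at s within UNIV)" and lq: "(q \<longlongrightarrow> q s) (at s within UNIV)"
      using p(1) q by (auto simp: continuous_on_def)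
    have "((\<lambda>t. B * norm (p t - p s) * norm (q s) + B * norm (q t - q s)) \<longlongrightarrow>
        B * norm (p s - p s) * norm (q s) + B * norm (q s - q s)) (at s within UNIV)"
      by (intro tendsto_intros lp lq)
    then have "((\<lambda>t. B * norm (p t - p s) * norm (q s) + B * norm (q t - q s)) \<longlongrightarrow> 0) (at s within UNIV)" by simp
    then have "((\<lambda>t. ?A (p t) (q t) - ?A (p s) (q s)) \<longlongrightarrow> 0) (at s within UNIV)"
    proof (rule Lim_null_comparison[rotated])
      show "\<forall>\<^sub>F t in at s within UNIV. norm (?A (p t) (q t) - ?A (p s) (q s)) \<le>
          B * norm (p t - p s) * norm (q s) + B * norm (q t - q s)"
      proof (intro always_eventually allI)
        fix t show "norm (?A (p t) (q t) - ?A (p s) (q s)) \<le> B * norm (p t - p s) * norm (q s) + B * norm (q t - q s)"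
          using one[of t s] two[of s t] by (simp add: abs_le_iff)
      qed
    qed
    then show "((\<lambda>t. ?A (p t) (q t)) \<longlongrightarrow> ?A (p s) (q s)) (at s within UNIV)"
      by (simp add: LIM_zero_iff)
  qed
qed

text \<open>Both conditions say that the hyperplane through \<open>x\<close> with normal \<open>u + t x\<close> supports \<open>K\<close>.\<close>

lemma section_support_eq_iff:
  assumes x: "norm x = 1" and u: "u \<bullet> x = 0"
  shows "support_fun (cone_section x) u = t \<longleftrightarrow> support_fun K (u + t *\<^sub>R x) = t"
proof -
  have le: "u \<bullet> cone_point x y \<le> t \<longleftrightarrow> (u + t *\<^sub>R x) \<bullet> y \<le> t"
    and eq: "u \<bullet> cone_point x y = t \<longleftrightarrow> (u + t *\<^sub>R x) \<bullet> y = t" if "y \<in> K" for y t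
    using less_one[OF x that] by (simp_all add: inner_cone_point_perp[OF u] inner_add_left field_simps)
  show ?thesis
  proof
    assume t: "support_fun (cone_section x) u = t"
    obtain z where z: "z \<in> cone_section x" "u \<bullet> z = t"
      using support_fun_attained[OF compact_section[OF x] section_nonempty] t by metis
    then obtain y where y: "y \<in> K" "z = cone_point x y" by (auto simp: cone_section_def)
    show "support_fun K (u + t *\<^sub>R x) = t"
    proof (rule support_fun_eqI[OF compact y(1)])
      show "(u + t *\<^sub>R x) \<bullet> y = t" using z y eq by blast
      fix w assume w: "w \<in> K"
      have "u \<bullet> cone_point x w \<le> t"
        unfolding t[symmetric] using w by (intro support_fun_upper[OF compact_section[OF x]]) (simp add: cone_section_def)
      then show "(u + t *\<^sub>R x) \<bullet> w \<le> t" using le[OF w] by blast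
    qed
  next
    assume t: "support_fun K (u + t *\<^sub>R x) = t"
    obtain y where y: "y \<in> K" "(u + t *\<^sub>R x) \<bullet> y = t"
      using support_fun_attained[OF compact nonempty] t by metis
    show "support_fun (cone_section x) u = t"
    proof (rule support_fun_eqI[OF compact_section[OF x]])
      show "cone_point x y \<in> cone_section x" using y by (simp add: cone_section_def)
      show "u \<bullet> cone_point x y = t" using y eq by blast
      fix z assume "z \<in> cone_section x"
      then obtain w where w: "w \<in> K" "z = cone_point x w" by (auto simp: cone_section_def)
      have "(u + t *\<^sub>R x) \<bullet> w \<le> t"
        using support_fun_upper[OF compact w(1), of "u + t *\<^sub>R x"] t by simp
      then show "u \<bullet> z \<le> t" using le[OF w(1)] w by blast
    qed
  qed
qed

text \<open>\<open>f s\<close> is the slope, seen from \<open>x s\<close>, of the supporting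
  hyperplane of \<open>K\<close> on the side of \<open>u s\<close>. It cuts the circle in a chord;
  from the other end of this chord the same hyperplane supports \<open>K\<close> on the opposite
  side, so constant width yields the functional equation of the chord map.\<close>

lemma support_constant_if_width_constant:
  assumes width: "\<And>x u. norm x = 1 \<Longrightarrow> norm u = 1 \<Longrightarrow> u \<bullet> x = 0 \<Longrightarrow> section_width x u = 2 * r"
    and r: "r \<noteq> 0" and e: "norm e1 = 1" "norm e2 = 1" "e1 \<bullet> e2 = 0"
  shows "support_fun (cone_section e1) e2 = r"
proof -
  define x where "x = (\<lambda>s. cos s *\<^sub>R e1 + sin s *\<^sub>R e2)"
  define u where "u = (\<lambda>s. cos s *\<^sub>R e2 - sin s *\<^sub>R e1)"
  have ee: "e1 \<bullet> e1 = 1" "e2 \<bullet> e2 = 1" using e by (simp_all add: norm_eq_1)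
  have nx: "norm (x s) = 1" for s
    unfolding x_def by (rule norm_cos_sin[OF e])
  have nu: "norm (u s) = 1" for s
    using norm_cos_sin[OF e(2,1), of "- s"] e by (simp add: u_def inner_commute)
  have ux: "u s \<bullet> x s = 0" for s
    using ee e(3) by (simp add: u_def x_def inner_add_right inner_diff_left inner_diff_right inner_commute)
  define f where "f = (\<lambda>s. support_fun (cone_section (x s)) (u s))"
  have "f 0 = r"
  proof (rule tangent_chord_map_constant[where f = f and s = 0, OF _ _ _ r])
    show "continuous_on UNIV f"
      unfolding f_def
      by (rule continuous_support_along[OF _ nx]) (auto simp: x_def u_def intro!: continuous_intros)
    show "f (s + 2 * pi) = f s" for s by (simp add: f_def x_def u_def)
    fix s
    define c where "c = arctan (f s)"
    define s' where "s' = s + pi - 2 * arctan (f s)"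
    have s': "s' = s + pi - 2 * c" by (simp add: s'_def c_def)
    have c: "cos c \<noteq> 0" "f s = sin c / cos c"
      using tan_arctan[of "f s"] cos_arctan_not_zero[of "f s"] by (simp_all add: c_def tan_def)
    \<comment> \<open>Both ends of the chord give the same normal: multiplied by
      \<open>cos c\<close>, either side becomes \<open>u (s - c)\<close>, the unit vector pointing
      to the middle of the arc from \<open>x s\<close> to \<open>x s'\<close>.\<close>
    have "u s + f s *\<^sub>R x s = - u s' + f s *\<^sub>R x s'"
    proof -
      have cs: "cos s' = - cos (s - 2 * c)" "sin s' = - sin (s - 2 * c)"
        unfolding s' by (simp_all add: cos_diff sin_diff cos_add sin_add)
      have k1: "cos c * cos s + sin c * sin s = cos (s - c)" "sin c * cos s - cos c * sin s = - sin (s - c)"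
        by (simp_all add: cos_diff sin_diff)
      have "cos ((s - 2 * c) + c) = cos (s - c)" "sin ((s - 2 * c) + c) = sin (s - c)"
        by (simp_all add: algebra_simps)
      then have k2: "- cos c * cos s' + sin c * sin s' = cos (s - c)" "sin c * cos s' + cos c * sin s' = - sin (s - c)"
        unfolding cs cos_add sin_add by (simp_all add: algebra_simps)
      have a1: "cos c *\<^sub>R u s + sin c *\<^sub>R x s = cos (s - c) *\<^sub>R e2 - sin (s - c) *\<^sub>R e1"
      proof -
        have "cos c *\<^sub>R u s + sin c *\<^sub>R x s = (cos c * cos s + sin c * sin s) *\<^sub>R e2 + (sin c * cos s - cos c * sin s) *\<^sub>R e1"
          by (simp add: u_def x_def algebra_simps)
        then show ?thesis unfolding k1 by simp
      qed
      have a2: "- (cos c *\<^sub>R u s') + sin c *\<^sub>R x s' = cos (s - c) *\<^sub>R e2 - sin (s - c) *\<^sub>R e1"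
      proof -
        have "- (cos c *\<^sub>R u s') + sin c *\<^sub>R x s' = (- cos c * cos s' + sin c * sin s') *\<^sub>R e2 + (sin c * cos s' + cos c * sin s') *\<^sub>R e1"
          by (simp add: u_def x_def algebra_simps)
        then show ?thesis unfolding k2 by simp
      qed
      have "cos c *\<^sub>R (u s + f s *\<^sub>R x s) = cos c *\<^sub>R (- u s' + f s *\<^sub>R x s')"
        using a1 a2 c by (simp add: scaleR_add_right scaleR_diff_right)
      then show ?thesis using c by simp
    qed
    moreover have "support_fun K (u s + f s *\<^sub>R x s) = f s"
      using section_support_eq_iff[OF nx ux, of s "f s"] by (simp add: f_def)
    ultimately have "support_fun K (- u s' + f s *\<^sub>R x s') = f s" by simp
    then have "support_fun (cone_section (x s')) (- u s') = f s"
      using section_support_eq_iff[OF nx, of "- u s'" s' "f s"] ux by simp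
    moreover have "f s' + support_fun (cone_section (x s')) (- u s') = 2 * r"
      using width[OF nx nu ux, of s'] by (simp add: section_width_def f_def)
    ultimately show "f (s + pi - 2 * arctan (f s)) = 2 * r - f s" unfolding s'_def by simp
  qed
  then show ?thesis by (simp add: f_def x_def u_def)
qed

text \<open>A line through a unit vector that meets the orthogonal hyperplane at distance
  \<open>r\<close> from the origin is itself at distance \<open>r / sqrt (1 + r\<^sup>2)\<close>
  from the origin, whence the radius.\<close>

theorem ball_if_width_constant:
  assumes width: "\<And>x u. norm x = 1 \<Longrightarrow> norm u = 1 \<Longrightarrow> u \<bullet> x = 0 \<Longrightarrow> section_width x u = 2 * r"
    and r: "r > 0" and dim: "DIM('a) \<ge> 2"
  shows "K = cball 0 (r / sqrt (1 + r\<^sup>2))"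
proof (rule eq_cball_if_support_fun_constant[OF compact convex nonempty])
  let ?q = "sqrt (1 + r\<^sup>2)"
  have q: "?q > 0" "?q * ?q = 1 + r\<^sup>2" by (auto intro: add_pos_nonneg)
  show "0 \<le> r / ?q" using r by simp
  fix \<phi> :: 'a assume \<phi>: "norm \<phi> = 1"
  obtain e where "e \<noteq> 0" "orthogonal \<phi> e" using orthogonal_to_vector_exists[OF dim] by blast
  then obtain e where e: "norm e = 1" "\<phi> \<bullet> e = 0"
    by (intro that[of "e /\<^sub>R norm e"]) (auto simp: orthogonal_def)
  have ee: "\<phi> \<bullet> \<phi> = 1" "e \<bullet> e = 1" "e \<bullet> \<phi> = 0" using \<phi> e by (simp_all add: norm_eq_1 inner_commute)
  \<comment> \<open>The orthonormal pair is rotated so that the supporting hyperplane seen from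
    \<open>e1\<close> has normal \<phi>: \<open>e2 + r *\<^sub>R e1\<close> is a positive multiple
    of \<phi>.\<close>
  define e1 e2 where "e1 = (r *\<^sub>R \<phi> + e) /\<^sub>R ?q" and "e2 = (\<phi> - r *\<^sub>R e) /\<^sub>R ?q"
  have i: "(r *\<^sub>R \<phi> + e) \<bullet> (r *\<^sub>R \<phi> + e) = ?q * ?q" "(\<phi> - r *\<^sub>R e) \<bullet> (\<phi> - r *\<^sub>R e) = ?q * ?q"
    "(r *\<^sub>R \<phi> + e) \<bullet> (\<phi> - r *\<^sub>R e) = 0"
    unfolding q(2) using ee e(2)
    by (simp_all add: inner_add_left inner_add_right inner_diff_left inner_diff_right power2_eq_square)
  have unit: "norm (a /\<^sub>R t) = 1" if "a \<bullet> a = t * t" "t > 0" for a :: 'a and t :: real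
  proof -
    have "norm a = t" using that by (simp add: norm_eq_sqrt_inner)
    then show ?thesis using that by simp
  qed
  have n1: "norm e1 = 1" "norm e2 = 1" "e1 \<bullet> e2 = 0"
    unfolding e1_def e2_def using unit[OF i(1) q(1)] unit[OF i(2) q(1)] i(3) by simp_all
  have s: "e2 + r *\<^sub>R e1 = ?q *\<^sub>R \<phi>"
  proof -
    have "e2 + r *\<^sub>R e1 = ((1 + r\<^sup>2) *\<^sub>R \<phi>) /\<^sub>R ?q"
      by (simp add: e1_def e2_def algebra_simps power2_eq_square)
    also have "\<dots> = ((?q * ?q) *\<^sub>R \<phi>) /\<^sub>R ?q" by (simp only: q(2))
    also have "\<dots> = ?q *\<^sub>R \<phi>"
    proof -
      have "inverse t * (t * t) = t" for t :: real by (cases "t = 0") auto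
      then show ?thesis by (simp only: scaleR_scaleR)
    qed
    finally show ?thesis .
  qed
  have "support_fun (cone_section e1) e2 = r"
    using width r n1 by (intro support_constant_if_width_constant) auto
  then have "support_fun K (?q *\<^sub>R \<phi>) = r"
    using section_support_eq_iff[OF n1(1), of e2 r] n1(3) s by (simp add: inner_commute)
  then show "support_fun K \<phi> = r / ?q"
    using support_fun_scaleR[OF compact nonempty, of ?q \<phi>] q(1) by (simp add: field_simps)
qed

lemma generated_cone_section:
  assumes x: "norm x = 1"
  shows "generated_cone K x \<inter> {y. x \<bullet> y = 0} = cone_section x"
proof
  show "generated_cone K x \<inter> {y. x \<bullet> y = 0} \<subseteq> cone_section x"
  proof
    fix z assume "z \<in> generated_cone K x \<inter> {y. x \<bullet> y = 0}"
    then obtain y t where z: "z = x + t *\<^sub>R (y - x)" "y \<in> K" "x \<bullet> z = 0" by (auto simp: generated_cone_def)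
    have "1 - x \<bullet> y > 0" using less_one[OF x z(2)] by simp
    moreover have "x \<bullet> (x + t *\<^sub>R (y - x)) = 0" using z(1,3) by simp
    then have "1 = t * (1 - x \<bullet> y)"
      using x by (simp add: inner_add_right inner_diff_right norm_eq_1 algebra_simps)
    ultimately have "t = inverse (1 - x \<bullet> y)" by (simp add: field_simps)
    then show "z \<in> cone_section x" using z by (simp add: cone_section_def cone_point_def)
  qed
  show "cone_section x \<subseteq> generated_cone K x \<inter> {y. x \<bullet> y = 0}"
  proof
    fix z assume z: "z \<in> cone_section x"
    then obtain y where y: "y \<in> K" "z = x + inverse (1 - x \<bullet> y) *\<^sub>R (y - x)"
      by (auto simp: cone_section_def cone_point_def)
    have "inverse (1 - x \<bullet> y) \<ge> 0" using less_one[OF x y(1)] by simp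
    with y section_perp[OF x z] show "z \<in> generated_cone K x \<inter> {y. x \<bullet> y = 0}"
      unfolding generated_cone_def by blast
  qed
qed

end

text \<open>From a relatively interior point a small move along the part of \<open>c\<close>
  orthogonal to \<open>a\<close> stays in \<open>L\<close>; if \<open>c\<close> is constant on
  \<open>L\<close>, this part vanishes.\<close>

lemma hyperplane_body_normal_unique:
  fixes L :: "'a::euclidean_space set"
  assumes L: "hyperplane_convex_body L"
  obtains a where "a \<noteq> 0" "\<And>c d. (\<And>y. y \<in> L \<Longrightarrow> c \<bullet> y = d) \<Longrightarrow> \<exists>s. c = s *\<^sub>R a"
proof -
  obtain a b where a: "a \<noteq> 0" "L \<subseteq> {y. a \<bullet> y = b}"
    and int: "(top_of_set {y. a \<bullet> y = b}) interior_of L \<noteq> {}"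
    using L by (auto simp: hyperplane_convex_body_def)
  then obtain p where "p \<in> (top_of_set {y. a \<bullet> y = b}) interior_of L" by blast
  then obtain T where T: "openin (top_of_set {y. a \<bullet> y = b}) T" "p \<in> T" "T \<subseteq> L"
    by (auto simp: interior_of_def)
  then obtain e where e: "e > 0" "ball p e \<inter> {y. a \<bullet> y = b} \<subseteq> T"
    by (meson openin_contains_ball)
  show ?thesis
  proof (rule that[OF a(1)])
    fix c d assume c: "\<And>y. y \<in> L \<Longrightarrow> c \<bullet> y = d"
    define q where "q = c - ((c \<bullet> a) / (a \<bullet> a)) *\<^sub>R a"
    have qa: "a \<bullet> q = 0" using a(1) by (simp add: q_def inner_diff_right inner_commute)
    have pL: "p \<in> L" using T by blast
    define t where "t = e / (norm q + 1)"
    have t: "t > 0" using e(1) by (simp add: t_def add_nonneg_pos)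
    have "norm (t *\<^sub>R q) < e"
    proof -
      have "t * norm q < t * (norm q + 1)" using t by simp
      also have "\<dots> = e" using add_nonneg_pos[OF norm_ge_zero[of q] zero_less_one] by (simp add: t_def)
      finally show ?thesis using t by simp
    qed
    then have "p + t *\<^sub>R q \<in> ball p e" by (simp add: dist_norm)
    moreover have "a \<bullet> (p + t *\<^sub>R q) = b" using qa a(2) pL by (auto simp: inner_add_right)
    ultimately have "p + t *\<^sub>R q \<in> L" using e T by blast
    then have "c \<bullet> (p + t *\<^sub>R q) = c \<bullet> p" using c pL by simp
    then have "c \<bullet> q = 0" using t by (simp add: inner_add_right)
    then have "q \<bullet> q = 0" using qa by (simp add: q_def inner_diff_left)
    then have "q = 0" by simp
    then show "\<exists>s. c = s *\<^sub>R a" by (auto simp: q_def)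
  qed
qed

lemma isometry_orthogonal_part:
  fixes f :: "'a::euclidean_space \<Rightarrow> 'a"
  assumes "\<And>u v. dist (f u) (f v) = dist u v"
  obtains g where "g \<in> orth_blinfuns" "\<And>u. f u = blinfun_apply g u + f 0"
proof -
  define h where "h = (\<lambda>u. f u - f 0)"
  have "orthogonal_transformation h"
    unfolding orthogonal_transformation_isometry using assms by (simp add: h_def dist_norm)
  then have "bounded_linear h" "\<And>u. norm (h u) = norm u"
    by (auto simp: orthogonal_transformation linear_conv_bounded_linear)
  then show ?thesis
    by (intro that[of "Blinfun h"]) (simp_all add: orth_blinfuns_def bounded_linear_Blinfun_apply, simp add: h_def)
qed

text \<open>The translation \<open>b\<close> contributes a term linear in \<open>u\<close>, which
  cancels between \<open>u\<close> and \<open>- u\<close> in widths, so that only the orthogonal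
  part of a congruence remains visible.\<close>

lemma support_fun_isometry_image:
  fixes S :: "'a::euclidean_space set"
  assumes S: "compact S" "S \<noteq> {}" and f: "\<And>u. f u = blinfun_apply g u + b" and g: "g \<in> orth_blinfuns"
  shows "support_fun (f ` S) (blinfun_apply g u) = support_fun S u + blinfun_apply g u \<bullet> b"
proof -
  obtain y where y: "y \<in> S" "u \<bullet> y = support_fun S u" by (rule support_fun_attained[OF S])
  have *: "blinfun_apply g u \<bullet> f z = u \<bullet> z + blinfun_apply g u \<bullet> b" for z
    by (simp add: f inner_add_right orth_blinfun_inner[OF g])
  have "compact (f ` S)"
    unfolding f by (intro compact_continuous_image continuous_intros S)
  then show ?thesis
    using y support_fun_upper[OF S(1)] by (intro support_fun_eqI[of _ "f y"]) (auto simp: *)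
qed

theorem theorem3:
  fixes k :: nat and K L :: "(real ^ 'n) set"
  assumes "k \<ge> 1"
    and "CARD('n) = 2 * k + 1"
    and "convex_body K"
    and "K \<subseteq> ball 0 1"
    and "hyperplane_convex_body L"
    and "\<And>x. x \<in> sphere 0 1 \<Longrightarrow>
           hyperplane_convex_body (generated_cone K x \<inter> {y. x \<bullet> y = 0}) \<and>
           congruent_sets (generated_cone K x \<inter> {y. x \<bullet> y = 0}) L"
  shows "\<exists>c r. r > 0 \<and> K = cball c r"
proof -
  interpret body_in_unit_ball K
    by unfold_locales (use assms(3,4) in \<open>auto simp: convex_body_def\<close>)
  have body: "hyperplane_convex_body (cone_section x)" and congr: "congruent_sets (cone_section x) L" if "norm x = 1" for x
    using assms(6)[of x] generated_cone_section[OF that] that by auto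
  obtain B where B: "B \<ge> 0" "\<And>x y :: real^'n. norm x = 1 \<Longrightarrow> y \<in> K \<Longrightarrow> norm (cone_point x y) \<le> B"
    "\<And>x x' y :: real^'n. norm x = 1 \<Longrightarrow> norm x' = 1 \<Longrightarrow> y \<in> K \<Longrightarrow> norm (cone_point x y - cone_point x' y) \<le> B * norm (x - x')"
    using section_lipschitz by blast
  have B': "\<forall>x x'. \<forall>y\<in>K. norm x = 1 \<longrightarrow> norm x' = 1 \<longrightarrow> norm (cone_point x y - cone_point x' y) \<le> B * norm (x - x')"
    using B(3) by blast
  note cs = compact_section section_nonempty
  have width_tangential: "section_width x (u + s *\<^sub>R x) = section_width x u" if "norm x = 1" for x u s
    using support_tangential[OF that, of u s] support_tangential[OF that, of "- u" "- s"] by (simp add: section_width_def)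
  \<comment> \<open>Zero width makes the inner product with \<open>u\<close> constant on the
    section, as it is with \<open>x\<close>; by uniqueness of the normal the two are
    parallel.\<close>
  have parallel: "\<exists>s. u = s *\<^sub>R x" if x: "norm x = 1" and u: "section_width x u = 0" for x u
  proof -
    obtain a where a: "a \<noteq> 0" "\<And>c d. (\<And>y. y \<in> cone_section x \<Longrightarrow> c \<bullet> y = d) \<Longrightarrow> \<exists>s. c = s *\<^sub>R a"
      using hyperplane_body_normal_unique[OF body[OF x]] by metis
    obtain s where s: "x = s *\<^sub>R a" using a(2)[of x 0] section_perp[OF x] by blast
    have "u \<bullet> y = support_fun (cone_section x) u" if y: "y \<in> cone_section x" for y
      using support_fun_upper[OF compact_section[OF x] y, of u] support_fun_upper[OF compact_section[OF x] y, of "- u"] u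
      by (simp add: section_width_def)
    then obtain s' where s': "u = s' *\<^sub>R a" using a(2)[of u] by blast
    have "s \<noteq> 0" using s x by auto
    then have "u = (s' / s) *\<^sub>R x" using s s' by simp
    then show ?thesis by blast
  qed
  have to_L: "\<exists>g\<in>orth_blinfuns. \<forall>u. section_width x u = support_fun L (blinfun_apply g u) + support_fun L (- blinfun_apply g u)"
    if x: "norm x = 1" for x
  proof -
    obtain f where f: "\<And>u v. dist (f u) (f v) = dist u v" "f ` cone_section x = L"
      using congr[OF x] by (auto simp: congruent_sets_def)
    obtain g where g: "g \<in> orth_blinfuns" "\<And>u. f u = blinfun_apply g u + f 0"
      using isometry_orthogonal_part[of f] f(1) by blast
    note im = support_fun_isometry_image[OF cs(1)[OF x] cs(2) g(2,1), unfolded f(2)]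
    have "section_width x u = support_fun L (blinfun_apply g u) + support_fun L (- blinfun_apply g u)" for u
      using im[of u] im[of "- u"] by (simp add: section_width_def blinfun.minus_right)
    then show ?thesis using g(1) by blast
  qed
  interpret congruent_seminorm_field section_width "2 * B" "2 * B"
  proof
    fix x u v :: "real^'n" and c s :: real assume x: "norm x = 1"
    show "section_width x (u + v) \<le> section_width x u + section_width x v"
      using support_fun_add_le[OF cs(1)[OF x] cs(2), of u v] support_fun_add_le[OF cs(1)[OF x] cs(2), of "- u" "- v"]
      by (simp add: section_width_def)
    show "section_width x (c *\<^sub>R u) = c * section_width x u" if "c \<ge> 0"
      using support_fun_scaleR[OF cs(1)[OF x] cs(2) that, of u] support_fun_scaleR[OF cs(1)[OF x] cs(2) that, of "- u"]
      by (simp add: section_width_def algebra_simps)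
    show "section_width x (u + s *\<^sub>R x) = section_width x u" by (rule width_tangential[OF x])
    show "section_width x (- u) = section_width x u" by (simp add: section_width_def)
    have "norm z \<le> B" if "z \<in> cone_section x" for z using that B(2)[OF x] by (auto simp: cone_section_def)
    note b = support_fun_le_bound[OF cs(1)[OF x] cs(2) this]
    show "section_width x u \<le> 2 * B * norm u"
      using b[of u] b[of "- u"] by (simp add: section_width_def)
  next
    fix x y u :: "real^'n" assume x: "norm x = 1" and y: "norm y = 1"
    note l = support_lipschitz[OF B' x y] support_lipschitz[OF B' y x]
    show "\<bar>section_width x u - section_width y u\<bar> \<le> 2 * B * norm (x - y) * norm u"
      using l(1)[of u] l(1)[of "- u"] l(2)[of u] l(2)[of "- u"]
      by (simp add: section_width_def norm_minus_commute abs_le_iff)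
    obtain g1 where g1: "g1 \<in> orth_blinfuns"
      "\<And>u. section_width x u = support_fun L (blinfun_apply g1 u) + support_fun L (- blinfun_apply g1 u)"
      using to_L[OF x] by blast
    obtain g2 where g2: "g2 \<in> orth_blinfuns"
      "\<And>u. section_width y u = support_fun L (blinfun_apply g2 u) + support_fun L (- blinfun_apply g2 u)"
      using to_L[OF y] by blast
    obtain g2' where g2': "g2' \<in> orth_blinfuns" "g2 o\<^sub>L g2' = id_blinfun" "g2' o\<^sub>L g2 = id_blinfun"
      by (rule orth_blinfun_inverse[OF g2(1)])
    have gg: "blinfun_apply g2 (blinfun_apply g2' u) = u" for u
      using g2'(2) by (metis blinfun_apply_blinfun_compose blinfun_apply_id_blinfun id_apply)
    define g where "g = g2' o\<^sub>L g1"
    have g: "g \<in> orth_blinfuns" unfolding g_def by (rule orth_blinfun_compose[OF g2'(1) g1(1)])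
    have w: "section_width y (blinfun_apply g u) = section_width x u" for u
      by (simp add: g_def g1(2) g2(2) gg)
    \<comment> \<open>\<open>x\<close> spans the kernel of the width at \<open>x\<close>, so
      \<open>g\<close> sends it to a multiple of \<open>y\<close>; preservation of norms leaves
      \<open>y\<close> and \<open>- y\<close>.\<close>
    have "section_width y (blinfun_apply g x) = 0"
    proof -
      have "section_width x x = section_width x 0" using width_tangential[OF x, of 0 1] by simp
      also have "\<dots> = 0"
        using support_fun_scaleR[OF cs(1)[OF x] cs(2), of 0 0] by (simp add: section_width_def)
      finally show ?thesis by (simp add: w)
    qed
    then obtain s where s: "blinfun_apply g x = s *\<^sub>R y" using parallel[OF y] by blast
    have "\<bar>s\<bar> = 1" using s norm_orth_blinfun[OF g, of x] x y by simp
    then consider "s = 1" | "s = -1" by linarith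
    then show "\<exists>g\<in>orth_blinfuns. blinfun_apply g x = y \<and> (\<forall>u. section_width y (blinfun_apply g u) = section_width x u)"
    proof cases
      case 1
      then show ?thesis using g w s by (intro bexI[of _ g]) auto
    next
      case 2
      \<comment> \<open>Reflection in the hyperplane orthogonal to \<open>x\<close> changes vectors
        only along \<open>x\<close>, so it preserves the width and corrects the sign.\<close>
      define R where "R = (\<lambda>u. u + (- 2 * (u \<bullet> x)) *\<^sub>R x)"
      have "bounded_linear R" unfolding R_def
        by (intro bounded_linear_intros)
      moreover have "norm (R u) = norm u" for u
      proof -
        have "x \<bullet> x = 1" using x by (simp add: norm_eq_1)
        then have "R u \<bullet> R u = u \<bullet> u"
          by (simp add: R_def inner_add_left inner_add_right inner_commute algebra_simps)
        then show ?thesis by (simp add: norm_eq_sqrt_inner)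
      qed
      ultimately have Ro: "Blinfun R \<in> orth_blinfuns" "\<And>u. blinfun_apply (Blinfun R) u = R u"
        by (simp_all add: orth_blinfuns_def bounded_linear_Blinfun_apply)
      have "R x = - x" using x by (simp add: R_def norm_eq_1 scaleR_2)
      then have "blinfun_apply g (R x) = y" using s 2 by (simp add: blinfun.minus_right)
      moreover have "section_width y (blinfun_apply g (R u)) = section_width x u" for u
        unfolding w R_def by (rule width_tangential[OF x])
      ultimately show ?thesis
        using orth_blinfun_compose[OF g Ro(1)] Ro(2) by (intro bexI[of _ "g o\<^sub>L Blinfun R"]) auto
    qed
  qed
  have "CARD('n) \<ge> 2" "odd (CARD('n))" using assms(1,2) by auto
  then obtain w where w: "\<And>x u. norm x = 1 \<Longrightarrow> norm u = 1 \<Longrightarrow> u \<bullet> x = 0 \<Longrightarrow> section_width x u = w"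
    using constant_on_unit_tangents by blast
  have dim: "DIM(real^'n) \<ge> 2" using \<open>CARD('n) \<ge> 2\<close> by simp
  obtain x :: "real^'n" where x: "norm x = 1" using exists_unit by blast
  obtain u where u: "u \<noteq> 0" "orthogonal x u" using orthogonal_to_vector_exists[OF dim] by blast
  let ?u = "u /\<^sub>R norm u"
  have u': "norm ?u = 1" "?u \<bullet> x = 0" using u by (auto simp: orthogonal_def inner_commute)
  \<comment> \<open>Zero width in the direction \<open>?u\<close> would make it parallel to
    \<open>x\<close>, to which it is orthogonal.\<close>
  have "w \<noteq> 0"
  proof
    assume "w = 0"
    then obtain s where "?u = s *\<^sub>R x" using parallel[OF x] w[OF x u'] by blast
    then show False using u' x by (metis inner_scaleR_left mult.right_neutral norm_eq_1 norm_zero scaleR_zero_left zero_neq_one)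
  qed
  moreover have "w \<ge> 0" using nonneg[OF x, of ?u] w[OF x u'] by simp
  ultimately have "w / 2 > 0" by simp
  moreover have "K = cball 0 ((w / 2) / sqrt (1 + (w / 2)\<^sup>2))"
    by (rule ball_if_width_constant) (use w \<open>w / 2 > 0\<close> dim in auto)
  moreover have "(w / 2) / sqrt (1 + (w / 2)\<^sup>2) > 0"
    using \<open>w / 2 > 0\<close> by (intro divide_pos_pos) (auto intro: add_pos_nonneg)
  ultimately show ?thesis by blast
qed

end
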